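(* Let $1<p\le 2\le q<\infty$ with $p<q$, and let $p<r<q$. Then every Pełczyński Decomposition operator $T\colon\ell_p\to\ell_q$ factors through $\ell_r$, and $\mathcal J^{\ell_2}\subseteq\mathcal J^{\ell_r}$.
   Context: For a Banach space $Z$, an operator $S\in L(\ell_p,\ell_q)$ factors through $Z$ if $S=AB$ with bounded linear $B\colon\ell_p\to Z$, $A\colon Z\to\ell_q$; $\mathcal J^Z$ denotes the operator-norm closure in $L(\ell_p,\ell_q)$ (bounded linear operators) of the set of all operators that factor through $Z$. For $1<s<\infty$, $\bigl(\bigoplus_{n=1}^\infty\ell_2^n\bigr)_s$ denotes the $\ell_s$-direct sum of the $\ell_2^n$; it is known to be isomorphic to $\ell_s$. Let $I_{2,p,q}\colon\bigl(\bigoplus_{n}\ell_2^n\bigr)_p\to\bigl(\bigoplus_{n}\ell_2^n\bigr)_q$ be the formal identity. A Pełczyński Decomposition operator is any operator $T=V I_{2,p,q}U\colon\ell_p\to\ell_q$, where $U\colon\ell_p\to\bigl(\bigoplus_{n}\ell_2^n\bigr)_p$ and $V\colon\bigl(\bigoplus_{n}\ell_2^n\bigr)_q\to\ell_q$ are (surjective) isomorphisms. *)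

theory Defs
  imports "HOL-Analysis.Analysis"
begin

text \<open>
  The scalar field is \<open>\<real>\<close> or \<open>\<complex>\<close>: up to isometric isomorphism these are the only fields
  that are finite-dimensional over the reals and have a multiplicative norm. A statement
  polymorphic in this class therefore covers exactly the real and the complex spaces.
\<close>

class scalar_field = real_normed_field + euclidean_space

instance real :: scalar_field ..
instance complex :: scalar_field ..

text \<open>
  The exponents are real variables of the theorem, so the spaces cannot be types. A space is a
  set of scalar families with pointwise vector operations, together with its norm.
\<close>

record ('i, 'k) fspace =
  points :: "('i \<Rightarrow> 'k) set"
  vnorm :: "('i \<Rightarrow> 'k) \<Rightarrow> real"

definition ell :: "real \<Rightarrow> (nat, 'k::scalar_field) fspace" where
  "ell p = \<lparr> points = {x. summable (\<lambda>n. norm (x n) powr p)},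
             vnorm = (\<lambda>x. (\<Sum>n. norm (x n) powr p) powr (1 / p)) \<rparr>"

definition ell2_fin :: "nat \<Rightarrow> (nat, 'k::scalar_field) fspace" where
  "ell2_fin n = \<lparr> points = {x. \<forall>i\<ge>n. x i = 0},
                  vnorm = (\<lambda>x. L2_set (\<lambda>i. norm (x i)) {..<n}) \<rparr>"

text \<open>The \<open>n\<close>-th component of a family \<open>x\<close> in a direct sum is \<open>\<lambda>i. x (n, i)\<close>.\<close>

definition direct_sum ::
  "real \<Rightarrow> (nat \<Rightarrow> ('i, 'k::scalar_field) fspace) \<Rightarrow> (nat \<times> 'i, 'k) fspace" where
  "direct_sum s X =
    \<lparr> points = {x. (\<forall>n. (\<lambda>i. x (n, i)) \<in> points (X n)) \<and>
                  summable (\<lambda>n. vnorm (X n) (\<lambda>i. x (n, i)) powr s)},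
      vnorm = (\<lambda>x. (\<Sum>n. vnorm (X n) (\<lambda>i. x (n, i)) powr s) powr (1 / s)) \<rparr>"

text \<open>The summands are \<open>\<ell>\<^sub>2\<^sup>n\<close> for \<open>n \<ge> 1\<close>, hence the shift of the index.\<close>

definition ell2_sum :: "real \<Rightarrow> (nat \<times> nat, 'k::scalar_field) fspace" where
  "ell2_sum s = direct_sum s (\<lambda>n. ell2_fin (Suc n))"

text \<open>
  Bounded linear operators. They are functions on the whole ambient type whose values outside
  \<open>points X\<close> are irrelevant: two of them denote the same operator iff they agree on \<open>points X\<close>.
\<close>

definition operators ::
  "('i, 'k::scalar_field) fspace \<Rightarrow> ('j, 'k) fspace \<Rightarrow> (('i \<Rightarrow> 'k) \<Rightarrow> ('j \<Rightarrow> 'k)) set" where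
  "operators X Y =
    {T. (\<forall>x\<in>points X. T x \<in> points Y) \<and>
        (\<forall>x\<in>points X. \<forall>y\<in>points X. T (\<lambda>i. x i + y i) = (\<lambda>j. T x j + T y j)) \<and>
        (\<forall>c. \<forall>x\<in>points X. T (\<lambda>i. c * x i) = (\<lambda>j. c * T x j)) \<and>
        (\<exists>C. \<forall>x\<in>points X. vnorm Y (T x) \<le> C * vnorm X x)}"

definition opnorm ::
  "('i, 'k::scalar_field) fspace \<Rightarrow> ('j, 'k) fspace \<Rightarrow> (('i \<Rightarrow> 'k) \<Rightarrow> ('j \<Rightarrow> 'k)) \<Rightarrow> real" where
  "opnorm X Y T = (SUP x\<in>{x\<in>points X. vnorm X x \<le> 1}. vnorm Y (T x))"

definition isomorphisms ::
  "('i, 'k::scalar_field) fspace \<Rightarrow> ('j, 'k) fspace \<Rightarrow> (('i \<Rightarrow> 'k) \<Rightarrow> ('j \<Rightarrow> 'k)) set" where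
  "isomorphisms X Y =
    {T\<in>operators X Y. \<exists>S\<in>operators Y X.
        (\<forall>x\<in>points X. S (T x) = x) \<and> (\<forall>y\<in>points Y. T (S y) = y)}"

definition factors_through ::
  "('l, 'k::scalar_field) fspace \<Rightarrow> ('i, 'k) fspace \<Rightarrow> ('j, 'k) fspace \<Rightarrow>
    (('i \<Rightarrow> 'k) \<Rightarrow> ('j \<Rightarrow> 'k)) \<Rightarrow> bool" where
  "factors_through Z X Y S \<longleftrightarrow>
    (\<exists>B\<in>operators X Z. \<exists>A\<in>operators Z Y. \<forall>x\<in>points X. S x = A (B x))"

definition closure_factoring ::
  "('l, 'k::scalar_field) fspace \<Rightarrow> real \<Rightarrow> real \<Rightarrow> ((nat \<Rightarrow> 'k) \<Rightarrow> (nat \<Rightarrow> 'k)) set" where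
  "closure_factoring Z p q =
    {T\<in>operators (ell p) (ell q). \<forall>\<epsilon>>0. \<exists>S\<in>operators (ell p) (ell q).
        factors_through Z (ell p) (ell q) S \<and>
        opnorm (ell p) (ell q) (\<lambda>x j. T x j - S x j) < \<epsilon>}"

text \<open>
  The formal identity from \<open>ell2_sum p\<close> to \<open>ell2_sum q\<close> is \<open>id\<close> on the common ambient type; for
  \<open>p \<le> q\<close> it maps the former space into the latter.
\<close>

definition pelczynski_operators ::
  "real \<Rightarrow> real \<Rightarrow> ((nat \<Rightarrow> 'k::scalar_field) \<Rightarrow> (nat \<Rightarrow> 'k)) set" where
  "pelczynski_operators p q =
    {T. \<exists>U\<in>isomorphisms (ell p) (ell2_sum p). \<exists>V\<in>isomorphisms (ell2_sum q) (ell q).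
        \<forall>x\<in>points (ell p). T x = V (id (U x))}"

end

theory Submission imports Defs begin

text \<open>
  Write \<open>X\<^sub>s\<close> for an \<open>\<ell>\<^sub>s\<close>-sum of finite-dimensional Hilbert spaces. Everything rests on one fact: for
  \<open>s \<le> r \<le> t\<close> with \<open>1 < r\<close>, the formal identity from \<open>X\<^sub>s\<close> to \<open>X\<^sub>t\<close> factors through \<open>\<ell>\<^sub>r\<close>, whatever the
  dimensions (\<open>block_sum_identity_factors\<close>). It passes through \<open>X\<^sub>r\<close>, and \<open>X\<^sub>r\<close> is
  complemented in \<open>\<ell>\<^sub>r\<close> because Rademacher functions span uniformly complemented copies of
  finite-dimensional Hilbert spaces (\<open>block_sum_complemented\<close>, from \<open>khintchine\<close> and its adjoint
  form \<open>rademacher_coefficients_bound\<close>). For Pelczynski decomposition operators the claim follows by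
  composing with the two isomorphisms (\<open>pelczynski_factors\<close>).

  For the inclusion of the closures, consider an operator between \<open>\<ell>\<^sub>p\<close> and \<open>\<ell>\<^sub>2\<close>, or between \<open>\<ell>\<^sub>2\<close>
  and \<open>\<ell>\<^sub>q\<close>. Since \<open>p > 1\<close>, both the rows and the columns of its matrix have small tails. With
  sufficiently fast growing blocks of coordinates the operator is therefore, up to a small error in
  norm, block tridiagonal (\<open>band_approximation\<close>). A block tridiagonal operator into \<open>\<ell>\<^sub>2\<close> is bounded even
  into \<open>X\<^sub>p\<close>, and one out of \<open>\<ell>\<^sub>2\<close> extends to \<open>X\<^sub>q\<close>, where \<open>\<ell>\<^sub>2\<close> is viewed as \<open>X\<^sub>2\<close>
  (\<open>band_part_into_ell2\<close>, \<open>band_part_from_ell2\<close>). So it contains the formal identity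
  from \<open>X\<^sub>p\<close> to \<open>X\<^sub>2\<close>, or from \<open>X\<^sub>2\<close> to \<open>X\<^sub>q\<close>, as a factor, and hence factors through \<open>\<ell>\<^sub>r\<close> if
  \<open>p \<le> r \<le> 2\<close> or \<open>2 \<le> r \<le> q\<close>, respectively (\<open>hilbert_approximation\<close>). Given a composition
  of operators from \<open>\<ell>\<^sub>p\<close> to \<open>\<ell>\<^sub>2\<close> and from \<open>\<ell>\<^sub>2\<close> to \<open>\<ell>\<^sub>q\<close>, one of the two factors is
  replaced in this way, depending on the side of \<open>2\<close> on which \<open>r\<close> lies.
\<close>

section \<open>Rademacher signs and Khintchine's inequality\<close>

text \<open>
  The product probability space \<open>{1, -1}\<^sup>n\<close> is represented by \<open>{..<2 ^ n}\<close>: the bits of \<open>j\<close> are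
  the outcomes, and \<open>rademacher i\<close> is the \<open>i\<close>-th coordinate function.
\<close>

definition rademacher :: "nat \<Rightarrow> nat \<Rightarrow> real" where
  "rademacher i j = (if even (j div 2 ^ i) then 1 else -1)"

lemma rademacher_square [simp]: "rademacher i j * rademacher i j = 1"
  by (auto simp: rademacher_def)

text \<open>
  This is the independence of the coordinates. Passing from \<open>n\<close> to \<open>n + 1\<close> appends to the numbers
  below \<open>2 ^ n\<close> their shifts by \<open>2 ^ n\<close>; the shift flips the sign of index \<open>n\<close> and keeps all
  lower ones.
\<close>

lemma sum_prod_rademacher:
  fixes f :: "nat \<Rightarrow> real \<Rightarrow> real"
  shows "(\<Sum>j<2 ^ n. \<Prod>i<n. f i (rademacher i j)) = (\<Prod>i<n. f i 1 + f i (-1))"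
proof (induction n)
  case 0
  then show ?case by simp
next
  case (Suc n)
  have low: "rademacher n j = 1" if "j < 2 ^ n" for j
    using that by (simp add: rademacher_def)
  have top: "rademacher n (j + 2 ^ n) = -1" if "j < 2 ^ n" for j
    using that by (simp add: rademacher_def)
  have shift: "rademacher i (j + 2 ^ n) = rademacher i j" if "i < n" for i j
  proof -
    have "(2::nat) ^ n = 2 ^ (n - i) * 2 ^ i"
      using that by (simp flip: power_add)
    then have "(j + 2 ^ n) div 2 ^ i = j div 2 ^ i + 2 ^ (n - i)"
      by simp
    then show ?thesis using that by (simp add: rademacher_def)
  qed
  define g where "g j = (\<Prod>i<n. f i (rademacher i j))" for j
  have split: "{..<2 ^ Suc n} = {..<2 ^ n} \<union> (\<lambda>j. j + 2 ^ n) ` {..<(2::nat) ^ n}"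
  proof (intro equalityI subsetI)
    fix j :: nat assume "j \<in> {..<2 ^ Suc n}"
    then show "j \<in> {..<2 ^ n} \<union> (\<lambda>j. j + 2 ^ n) ` {..<2 ^ n}"
      by (cases "j < 2 ^ n") (auto intro!: image_eqI[of _ _ "j - 2 ^ n"])
  qed auto
  have "(\<Sum>j<2 ^ Suc n. \<Prod>i<Suc n. f i (rademacher i j))
      = (\<Sum>j<2 ^ n. \<Prod>i<Suc n. f i (rademacher i j))
        + (\<Sum>j<2 ^ n. \<Prod>i<Suc n. f i (rademacher i (j + 2 ^ n)))"
    unfolding split by (subst sum.union_disjoint) (auto simp: sum.reindex inj_on_def)
  also have "\<dots> = (\<Sum>j<2 ^ n. g j * f n 1) + (\<Sum>j<2 ^ n. g j * f n (-1))"
    by (simp add: low top shift g_def)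
  also have "\<dots> = (\<Prod>i<n. f i 1 + f i (-1)) * (f n 1 + f n (-1))"
    using Suc by (simp add: g_def sum_distrib_right[symmetric] distrib_left)
  finally show ?case by simp
qed

lemma rademacher_orthogonal:
  assumes "i < n" "l < n" "i \<noteq> l"
  shows "(\<Sum>j<2 ^ n. rademacher i j * rademacher l j) = 0"
proof -
  define f where "f m s = (if m = i \<or> m = l then s else (1::real))" for m s
  have "(\<Prod>m<n. f m (rademacher m j)) = rademacher i j * rademacher l j" for j
  proof -
    have "(\<Prod>m<n. f m (rademacher m j)) = (\<Prod>m\<in>{i,l}. f m (rademacher m j))"
      by (rule prod.mono_neutral_right) (use assms in \<open>auto simp: f_def\<close>)
    then show ?thesis using assms by (simp add: f_def)
  qed
  then have "(\<Sum>j<2 ^ n. rademacher i j * rademacher l j) = (\<Prod>m<n. f m 1 + f m (-1))"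
    using sum_prod_rademacher[of f n] by simp
  also have "\<dots> = 0"
    using assms by (intro prod_zero) (auto simp: f_def intro: bexI[of _ i])
  finally show ?thesis .
qed

text \<open>
  Without aiming at the optimal exponent \<open>x\<^sup>2 / 2\<close>, this follows from
  \<open>exp x \<le> 1 + x + x\<^sup>2\<close> on the unit interval and from \<open>\<bar>x\<bar> \<le> x\<^sup>2\<close> outside of it.
\<close>

lemma two_cosh_le: "exp x + exp (- x) \<le> 2 * exp (x\<^sup>2 :: real)"
proof (cases "\<bar>x\<bar> \<le> 1")
  case True
  have "exp x \<le> 1 + x + x\<^sup>2" if "\<bar>x\<bar> \<le> 1" for x :: real
  proof (cases "x \<ge> 0")
    case True
    then show ?thesis using exp_bound[of x] that by simp
  next
    case False
    have "exp x = 1 / exp (- x)" by (simp add: exp_minus field_simps)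
    also have "\<dots> \<le> 1 / (1 - x)"
      using exp_ge_add_one_self[of "-x"] False by (intro divide_left_mono) auto
    also have "\<dots> \<le> 1 + x + x\<^sup>2"
    proof -
      have "(1 + x + x\<^sup>2) * (1 - x) = 1 - x ^ 3" by (simp add: field_simps power2_eq_square power3_eq_cube)
      also have "\<dots> \<ge> 1" using False by (simp add: power_le_zero_eq)
      finally show ?thesis using False by (simp add: divide_le_eq)
    qed
    finally show ?thesis .
  qed
  from this[of x] this[of "-x"] True have "exp x + exp (- x) \<le> 2 * (1 + x\<^sup>2)" by simp
  also have "\<dots> \<le> 2 * exp (x\<^sup>2)" by (intro mult_left_mono exp_ge_add_one_self) auto
  finally show ?thesis .
next
  case False
  then have "1 * \<bar>x\<bar> \<le> \<bar>x\<bar> * \<bar>x\<bar>" by (intro mult_right_mono) auto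
  then have "\<bar>x\<bar> \<le> x\<^sup>2" by (simp add: power2_eq_square flip: abs_mult)
  then have "exp x \<le> exp (x\<^sup>2)" "exp (-x) \<le> exp (x\<^sup>2)" by simp_all
  then have "exp x + exp (- x) \<le> exp (x\<^sup>2) + exp (x\<^sup>2)" by (rule add_mono)
  then show ?thesis by simp
qed

lemma powr_le_exp:
  fixes r :: real
  assumes "0 \<le> r"
  obtains C where "C \<ge> 0" "\<And>x. x \<ge> 0 \<Longrightarrow> x powr r \<le> C * exp x"
proof
  let ?m = "nat \<lceil>r\<rceil>"
  show "(fact ?m :: real) \<ge> 0" by simp
  fix x :: real assume x: "x \<ge> 0"
  show "x powr r \<le> fact ?m * exp x"
  proof (cases "x \<le> 1")
    case True
    have "x powr r \<le> 1 * 1" using True x assms by (simp add: powr_le1)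
    also have "\<dots> \<le> fact ?m * exp x" using x by (intro mult_mono) (auto simp: fact_ge_1)
    finally show ?thesis .
  next
    case False
    have "x powr r \<le> x powr real ?m" using False assms by (intro powr_mono) linarith+
    also have "\<dots> = x ^ ?m" using False by (simp add: powr_realpow)
    also have "\<dots> \<le> fact ?m * exp x"
    proof -
      have s: "(\<lambda>n. x ^ n /\<^sub>R fact n) sums exp x" by (rule exp_converges)
      have "sum (\<lambda>n. x ^ n /\<^sub>R fact n) {?m} \<le> exp x"
        using s x by (intro sum_le_suminf[THEN order_trans, of _ "{?m}" "exp x"])
          (auto simp: sums_iff)
      then show ?thesis by (simp add: field_simps)
    qed
    finally show ?thesis .
  qed
qed

text \<open>
  A Rademacher sum \<open>X\<close> with square-summable coefficients is sub-Gaussian: by independence,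
  \<open>exp X\<close> and \<open>exp (-X)\<close> have expectations at most \<open>exp (\<Sum>i<n. (a i)\<^sup>2)\<close>, and these dominate
  every moment of \<open>X\<close> up to a factor that depends on the exponent only.
\<close>

lemma khintchine_real:
  fixes r :: real
  assumes "0 \<le> r"
  obtains K where "K \<ge> 0" "\<And>n a. (\<Sum>i<n. (a i)\<^sup>2) \<le> 1 \<Longrightarrow>
     (\<Sum>j<2 ^ n. \<bar>\<Sum>i<n. rademacher i j * a i\<bar> powr r) \<le> K * 2 ^ n"
proof -
  obtain C where C: "C \<ge> 0" "\<And>x. x \<ge> 0 \<Longrightarrow> x powr r \<le> C * exp x"
    using powr_le_exp[OF assms] by blast
  have "(\<Sum>j<2 ^ n. \<bar>\<Sum>i<n. rademacher i j * a i\<bar> powr r) \<le> 2 * C * exp 1 * 2 ^ n"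
    if a: "(\<Sum>i<n. (a i)\<^sup>2) \<le> 1" for n a
  proof -
    define X where "X j = (\<Sum>i<n. rademacher i j * a i)" for j
    have moment: "(\<Sum>j<2 ^ n. exp (s * X j)) \<le> 2 ^ n * exp 1" if s: "s\<^sup>2 = 1" for s
    proof -
      have "(\<Sum>j<2 ^ n. exp (s * X j)) = (\<Sum>j<2 ^ n. \<Prod>i<n. exp (s * (rademacher i j * a i)))"
        by (simp add: X_def sum_distrib_left exp_sum)
      also have "\<dots> = (\<Prod>i<n. exp (s * a i) + exp (- (s * a i)))"
        using sum_prod_rademacher[of "\<lambda>i e. exp (s * (e * a i))" n] by simp
      also have "\<dots> \<le> (\<Prod>i<n. 2 * exp ((a i)\<^sup>2))"
      proof (rule prod_mono)
        fix i
        have "exp (s * a i) + exp (- (s * a i)) \<le> 2 * exp ((s * a i)\<^sup>2)" by (rule two_cosh_le)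
        then show "0 \<le> exp (s * a i) + exp (- (s * a i)) \<and>
            exp (s * a i) + exp (- (s * a i)) \<le> 2 * exp ((a i)\<^sup>2)"
          using s by (simp add: power_mult_distrib add_nonneg_nonneg)
      qed
      also have "\<dots> = 2 ^ n * exp (\<Sum>i<n. (a i)\<^sup>2)" by (simp add: prod.distrib exp_sum)
      also have "\<dots> \<le> 2 ^ n * exp 1" using a by simp
      finally show ?thesis .
    qed
    have "\<bar>X j\<bar> powr r \<le> C * (exp (1 * X j) + exp (-1 * X j))" for j
    proof -
      have "\<bar>X j\<bar> powr r \<le> C * exp \<bar>X j\<bar>" by (rule C) simp
      also have "\<dots> \<le> C * (exp (1 * X j) + exp (-1 * X j))"
        using C(1) by (intro mult_left_mono) (auto simp: abs_if)
      finally show ?thesis .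
    qed
    then have "(\<Sum>j<2 ^ n. \<bar>X j\<bar> powr r) \<le> (\<Sum>j<2 ^ n. C * (exp (1 * X j) + exp (-1 * X j)))"
      by (rule sum_mono)
    also have "\<dots> = C * ((\<Sum>j<2 ^ n. exp (1 * X j)) + (\<Sum>j<2 ^ n. exp (-1 * X j)))"
      by (simp add: sum_distrib_left sum.distrib distrib_left)
    also have "\<dots> \<le> C * (2 ^ n * exp 1 + 2 ^ n * exp 1)"
      using C(1) moment[of 1] moment[of "-1"] by (intro mult_left_mono add_mono) auto
    finally show ?thesis by (simp add: X_def algebra_simps)
  qed
  then show thesis using C(1) by (intro that[of "2 * C * exp 1"]) auto
qed

text \<open>
  The sum is at most \<open>card A\<close> times its largest term. This crude bound serves as triangle
  inequality below, where the sums have boundedly many terms and constants do not matter.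
\<close>

lemma powr_sum_le:
  fixes f :: "'a \<Rightarrow> real"
  assumes "finite A" "r \<ge> 0" "\<And>i. i \<in> A \<Longrightarrow> f i \<ge> 0"
  shows "(\<Sum>i\<in>A. f i) powr r \<le> real (card A) powr r * (\<Sum>i\<in>A. f i powr r)"
proof (cases "A = {}")
  case False
  define m where "m = Max (f ` A)"
  have "m \<in> f ` A" unfolding m_def using assms False by (intro Max_in) auto
  then obtain i where i: "i \<in> A" "m = f i" by auto
  have "(\<Sum>i\<in>A. f i) \<le> real (card A) * m"
    using assms by (intro sum_bounded_above) (simp add: m_def)
  then have "(\<Sum>i\<in>A. f i) powr r \<le> (real (card A) * m) powr r"
    using assms by (intro powr_mono2) (auto intro: sum_nonneg)
  also have "\<dots> = real (card A) powr r * f i powr r"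
    using i assms by (simp add: powr_mult)
  also have "\<dots> \<le> real (card A) powr r * (\<Sum>i\<in>A. f i powr r)"
    using assms i by (intro mult_left_mono member_le_sum) auto
  finally show ?thesis .
qed simp

text \<open>
  This is the upper half of Khintchine's inequality; the role of the lower half is played by duality,
  that is, by the same inequality for the conjugate exponent. Vector-valued coefficients reduce to
  real ones coordinatewise, which treats real and complex scalars together.
\<close>

theorem khintchine:
  fixes r :: real
  assumes "0 < r"
  obtains K where "K \<ge> 0" "\<And>n (a :: nat \<Rightarrow> 'a::euclidean_space).
     (\<Sum>j<2 ^ n. norm (\<Sum>i<n. rademacher i j *\<^sub>R a i) powr r)
        \<le> K * 2 ^ n * L2_set (\<lambda>i. norm (a i)) {..<n} powr r"
proof -
  obtain K where K: "K \<ge> 0" "\<And>n a. (\<Sum>i<n. (a i)\<^sup>2) \<le> 1 \<Longrightarrow>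
     (\<Sum>j<2 ^ n. \<bar>\<Sum>i<n. rademacher i j * a i\<bar> powr r) \<le> K * 2 ^ n"
    using khintchine_real[of r] assms by auto
  define D where "D = real (card (Basis :: 'a set))"
  have "(\<Sum>j<2 ^ n. norm (\<Sum>i<n. rademacher i j *\<^sub>R a i) powr r)
        \<le> D powr r * (D * K) * 2 ^ n * L2_set (\<lambda>i. norm (a i)) {..<n} powr r"
    for n and a :: "nat \<Rightarrow> 'a"
  proof -
    define c where "c = L2_set (\<lambda>i. norm (a i)) {..<n}"
    show ?thesis
    proof (cases "c = 0")
      case True
      then have "\<forall>i<n. a i = 0" by (simp add: c_def L2_set_eq_0_iff)
      then show ?thesis using True by (simp add: c_def)
    next
      case False
      then have c: "c > 0" using L2_set_nonneg[of "\<lambda>i. norm (a i)" "{..<n}"] by (simp add: c_def less_le)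
      have coord: "(\<Sum>j<2 ^ n. \<bar>(\<Sum>i<n. rademacher i j *\<^sub>R a i) \<bullet> b\<bar> powr r) \<le> K * 2 ^ n * c powr r"
        if b: "b \<in> Basis" for b
      proof -
        have "(\<Sum>i<n. (a i \<bullet> b / c)\<^sup>2) \<le> (\<Sum>i<n. (norm (a i))\<^sup>2 / c\<^sup>2)"
        proof (rule sum_mono)
          fix i
          have "\<bar>a i \<bullet> b\<bar>\<^sup>2 \<le> (norm (a i))\<^sup>2"
            using Basis_le_norm[OF b, of "a i"] by (intro power_mono) auto
          then show "(a i \<bullet> b / c)\<^sup>2 \<le> (norm (a i))\<^sup>2 / c\<^sup>2"
            using c by (simp add: power_divide divide_right_mono)
        qed
        also have "\<dots> = (\<Sum>i<n. (norm (a i))\<^sup>2) / c\<^sup>2"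
          by (simp add: sum_divide_distrib)
        also have "(\<Sum>i<n. (norm (a i))\<^sup>2) = c\<^sup>2" by (simp add: c_def L2_set_def sum_nonneg)
        finally have "(\<Sum>i<n. (a i \<bullet> b / c)\<^sup>2) \<le> 1" using c by simp
        from K(2)[OF this] have "(\<Sum>j<2 ^ n. \<bar>\<Sum>i<n. rademacher i j * (a i \<bullet> b / c)\<bar> powr r) \<le> K * 2 ^ n" .
        moreover have "\<bar>(\<Sum>i<n. rademacher i j *\<^sub>R a i) \<bullet> b\<bar> powr r
            = c powr r * \<bar>\<Sum>i<n. rademacher i j * (a i \<bullet> b / c)\<bar> powr r" for j
        proof -
          have "(\<Sum>i<n. rademacher i j *\<^sub>R a i) \<bullet> b = c * (\<Sum>i<n. rademacher i j * (a i \<bullet> b / c))"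
            using c by (simp add: inner_sum_left sum_distrib_left)
          then show ?thesis using c by (simp add: abs_mult powr_mult)
        qed
        ultimately show ?thesis using c
          by (simp add: sum_distrib_left[symmetric] mult.commute)
      qed
      have "(\<Sum>j<2 ^ n. norm (\<Sum>i<n. rademacher i j *\<^sub>R a i) powr r)
         \<le> (\<Sum>j<2 ^ n. D powr r * (\<Sum>b\<in>Basis. \<bar>(\<Sum>i<n. rademacher i j *\<^sub>R a i) \<bullet> b\<bar> powr r))"
      proof (rule sum_mono)
        fix j
        let ?y = "\<Sum>i<n. rademacher i j *\<^sub>R a i"
        have "norm ?y powr r \<le> (\<Sum>b\<in>Basis. \<bar>?y \<bullet> b\<bar>) powr r"
          using assms by (intro powr_mono2 norm_le_l1) auto
        also have "\<dots> \<le> D powr r * (\<Sum>b\<in>Basis. \<bar>?y \<bullet> b\<bar> powr r)"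
          unfolding D_def using assms by (intro powr_sum_le) auto
        finally show "norm ?y powr r \<le> D powr r * (\<Sum>b\<in>Basis. \<bar>?y \<bullet> b\<bar> powr r)" .
      qed
      also have "\<dots> = D powr r * (\<Sum>b\<in>Basis. \<Sum>j<2 ^ n. \<bar>(\<Sum>i<n. rademacher i j *\<^sub>R a i) \<bullet> b\<bar> powr r)"
        by (subst sum.swap) (simp add: sum_distrib_left)
      also have "\<dots> \<le> D powr r * (\<Sum>b\<in>(Basis::'a set). K * 2 ^ n * c powr r)"
        using coord by (intro mult_left_mono sum_mono) auto
      finally show ?thesis by (simp add: D_def c_def mult_ac)
    qed
  qed
  then show thesis using K(1) by (intro that[of "D powr r * (D * K)"]) (auto simp: D_def)
qed

lemma holder_sum:
  fixes a b :: "'a \<Rightarrow> real"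
  assumes "p > 1" "q > 1" "1 / p + 1 / q = 1" "\<And>i. i \<in> A \<Longrightarrow> a i \<ge> 0" "\<And>i. i \<in> A \<Longrightarrow> b i \<ge> 0"
  shows "(\<Sum>i\<in>A. a i * b i) \<le> (\<Sum>i\<in>A. a i powr p) powr (1 / p) * (\<Sum>i\<in>A. b i powr q) powr (1 / q)"
proof (cases "finite A")
  case True
  let ?s = "\<Sum>i\<in>A. a i powr p" and ?t = "\<Sum>i\<in>A. b i powr q"
  have s0: "?s \<ge> 0" and t0: "?t \<ge> 0" by (auto intro: sum_nonneg)
  show ?thesis
  proof (cases "?s = 0 \<or> ?t = 0")
    case True
    then have "\<forall>i\<in>A. a i * b i = 0"
      using \<open>finite A\<close> by (auto simp: sum_nonneg_eq_0_iff)
    then have "(\<Sum>i\<in>A. a i * b i) = 0" by (intro sum.neutral)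
    then show ?thesis by simp
  next
    case False
    then have st: "?s > 0" "?t > 0" using s0 t0 by auto
    define S T where "S = ?s powr (1 / p)" and "T = ?t powr (1 / q)"
    have ST: "S > 0" "T > 0" "S powr p = ?s" "T powr q = ?t"
      using st assms(1,2) by (auto simp: S_def T_def powr_powr)
    have "(\<Sum>i\<in>A. (a i / S) * (b i / T)) \<le> (\<Sum>i\<in>A. (a i / S) powr p / p + (b i / T) powr q / q)"
      using assms ST by (intro sum_mono Youngs_inequality) auto
    also have "\<dots> = (\<Sum>i\<in>A. a i powr p / ?s / p) + (\<Sum>i\<in>A. b i powr q / ?t / q)"
      unfolding sum.distrib[symmetric]
      using assms ST by (intro sum.cong) (auto simp: powr_divide)
    also have "\<dots> = 1"
      using st assms(3) by (simp only: sum_divide_distrib[symmetric]) simp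
    finally have "(\<Sum>i\<in>A. a i * b i) / (S * T) \<le> 1"
      by (simp add: sum_divide_distrib)
    then show ?thesis using ST by (simp add: divide_le_eq S_def T_def)
  qed
qed simp

text \<open>
  The map from a function to its Rademacher coefficients is the adjoint of the map
  \<open>a \<mapsto> \<Sum>i<n. rademacher i j *\<^sub>R a i\<close>, so its bound is Khintchine's inequality for the conjugate
  exponent. Concretely, pair the coefficient vector \<open>y\<close> with itself, move the pairing to the side
  of \<open>f\<close> and apply Hoelder's inequality. This is where \<open>1 < r\<close> enters.
\<close>

lemma rademacher_coefficients_bound:
  fixes r :: real
  assumes "1 < r"
  obtains K where "K \<ge> 0" "\<And>n (f :: nat \<Rightarrow> 'a::euclidean_space).
     L2_set (\<lambda>i. norm ((\<Sum>j<2 ^ n. rademacher i j *\<^sub>R f j) /\<^sub>R 2 ^ n)) {..<n} powr r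
        \<le> K * ((\<Sum>j<2 ^ n. norm (f j) powr r) / 2 ^ n)"
proof -
  define r' where "r' = r / (r - 1)"
  have r': "r' > 1" "1 / r + 1 / r' = 1" using assms by (auto simp: r'_def field_simps)
  obtain K where K: "K \<ge> 0" "\<And>n (a :: nat \<Rightarrow> 'a).
     (\<Sum>j<2 ^ n. norm (\<Sum>i<n. rademacher i j *\<^sub>R a i) powr r')
        \<le> K * 2 ^ n * L2_set (\<lambda>i. norm (a i)) {..<n} powr r'"
    using khintchine[of r', where 'a='a] r' by auto
  have "L2_set (\<lambda>i. norm ((\<Sum>j<2 ^ n. rademacher i j *\<^sub>R f j) /\<^sub>R 2 ^ n)) {..<n} powr r
        \<le> (K powr (r / r')) * ((\<Sum>j<2 ^ n. norm (f j) powr r) / 2 ^ n)" 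
    for n and f :: "nat \<Rightarrow> 'a"
  proof -
    define y where "y i = (\<Sum>j<2 ^ n. rademacher i j *\<^sub>R f j) /\<^sub>R 2 ^ n" for i
    define c where "c = L2_set (\<lambda>i. norm (y i)) {..<n}"
    define Y where "Y j = (\<Sum>i<n. rademacher i j *\<^sub>R y i)" for j
    define S where "S = (\<Sum>j<2 ^ n. norm (f j) powr r)"
    have S0: "S \<ge> 0" by (auto simp: S_def intro: sum_nonneg)
    have c0: "c \<ge> 0" by (simp add: c_def L2_set_nonneg)
    have "c\<^sup>2 = (\<Sum>i<n. y i \<bullet> y i)"
      by (simp add: c_def L2_set_def sum_nonneg power2_norm_eq_inner)
    also have "\<dots> = (\<Sum>i<n. \<Sum>j<2 ^ n. (f j \<bullet> (rademacher i j *\<^sub>R y i)) / 2 ^ n)"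
      by (subst (1) y_def)
        (simp add: inner_sum_left sum_distrib_left divide_inverse mult_ac)
    also have "\<dots> = (\<Sum>j<2 ^ n. f j \<bullet> Y j) / 2 ^ n"
      by (subst sum.swap) (simp add: Y_def inner_sum_right sum_divide_distrib)
    also have "\<dots> \<le> (\<Sum>j<2 ^ n. norm (f j) * norm (Y j)) / 2 ^ n"
      by (intro divide_right_mono sum_mono norm_cauchy_schwarz) simp
    also have "\<dots> \<le> (S powr (1 / r) * (\<Sum>j<2 ^ n. norm (Y j) powr r') powr (1 / r')) / 2 ^ n"
      unfolding S_def using assms r' by (intro divide_right_mono holder_sum) auto
    also have "\<dots> \<le> (S powr (1 / r) * (K * 2 ^ n * c powr r') powr (1 / r')) / 2 ^ n"
      unfolding Y_def c_def using r'
      by (intro divide_right_mono mult_left_mono powr_mono2 K) (auto intro: sum_nonneg)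
    also have "\<dots> = (S powr (1 / r) * K powr (1 / r') * 2 powr (n / r') / 2 powr n) * c"
      using r' K(1) c0 by (simp add: powr_mult powr_powr powr_realpow[symmetric])
    finally have le: "c * c \<le> (S powr (1 / r) * K powr (1 / r') * 2 powr (n / r') / 2 powr n) * c"
      by (simp add: power2_eq_square)
    have "c \<le> S powr (1 / r) * K powr (1 / r') * 2 powr (n / r') / 2 powr n"
    proof (cases "c = 0")
      case False
      then show ?thesis using le c0 by (intro mult_right_le_imp_le[OF le]) simp
    qed simp
    also have "\<dots> = S powr (1 / r) * K powr (1 / r') * 2 powr (- n / r)"
    proof -
      have "n / r' - n = n * (1 / r' - 1)" by (simp add: field_simps)
      also have "1 / r' - 1 = - (1 / r)" using r'(2) by linarith
      also have "n * - (1 / r) = - n / r" by simp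
      finally show ?thesis by (simp add: powr_diff[symmetric] mult.assoc flip: times_divide_eq_right)
    qed
    finally have "c powr r \<le> (S powr (1 / r) * K powr (1 / r') * 2 powr (- n / r)) powr r"
      using assms c0 by (intro powr_mono2) auto
    also have "\<dots> = K powr (r / r') * (S / 2 ^ n)"
    proof -
      have "(2 powr (- n / r)) powr r = 2 powr - real n"
        unfolding powr_powr using assms by simp
      also have "\<dots> = 1 / 2 ^ n" by (simp add: powr_minus_divide powr_realpow)
      finally show ?thesis using assms S0 K(1)
        by (simp add: powr_mult powr_powr)
    qed
    finally show ?thesis by (simp add: c_def y_def S_def)
  qed
  then show thesis by (intro that[of "K powr (r / r')"]) auto
qed

section \<open>Norms of sequences and of block sums\<close>

text \<open>
  Convergence and norm estimates are obtained together from uniform bounds on finite partial sums;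
  all later estimates are therefore about finite sums.
\<close>

lemma lp_norm_le_iff:
  fixes a :: "nat \<Rightarrow> real"
  assumes "0 < s" "0 \<le> c"
  shows "summable (\<lambda>n. a n powr s) \<and> (\<Sum>n. a n powr s) powr (1 / s) \<le> c \<longleftrightarrow>
         (\<forall>N. (\<Sum>n<N. a n powr s) \<le> c powr s)" (is "?L \<longleftrightarrow> ?R")
proof
  assume L: ?L
  let ?S = "\<Sum>n. a n powr s"
  have S: "?S \<ge> 0" by (rule suminf_nonneg) (use L in auto)
  have "(?S powr (1 / s)) powr s \<le> c powr s" using L assms by (intro powr_mono2) auto
  then have "?S \<le> c powr s" using S assms by (simp add: powr_powr)
  moreover have "(\<Sum>n<N. a n powr s) \<le> ?S" for N using L by (intro sum_le_suminf) auto
  ultimately show ?R by (meson order_trans)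
next
  assume R: ?R
  have sm: "summable (\<lambda>n. a n powr s)"
    by (rule bounded_imp_summable[of _ "c powr s"])
       (use R[rule_format, of "Suc _"] in \<open>auto simp: lessThan_Suc_atMost\<close>)
  have "(\<Sum>n. a n powr s) \<le> c powr s" by (rule suminf_le_const[OF sm]) (use R in auto)
  then have "(\<Sum>n. a n powr s) powr (1 / s) \<le> (c powr s) powr (1 / s)"
    using assms sm by (intro powr_mono2) (auto intro: suminf_nonneg)
  then show ?L using assms sm by (simp add: powr_powr)
qed

lemma lp_norm_mono:
  fixes a :: "nat \<Rightarrow> real"
  assumes "0 < s" "s \<le> t" "0 \<le> c" "\<And>n. a n \<ge> 0" and le: "\<And>N. (\<Sum>n<N. a n powr s) \<le> c powr s"
  shows "(\<Sum>n<N. a n powr t) \<le> c powr t"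
proof -
  have ac: "a n \<le> c" for n
  proof -
    have "a n powr s \<le> (\<Sum>n<Suc n. a n powr s)" by (rule member_le_sum) auto
    also have "\<dots> \<le> c powr s" by (rule le)
    finally show ?thesis using assms powr_less_mono2[of s c "a n"] by fastforce
  qed
  have "(\<Sum>n<N. a n powr t) \<le> (\<Sum>n<N. a n powr s * c powr (t - s))"
  proof (rule sum_mono)
    fix n
    have "a n powr t = a n powr s * a n powr (t - s)" by (simp flip: powr_add)
    also have "\<dots> \<le> a n powr s * c powr (t - s)"
      using ac assms by (intro mult_left_mono powr_mono2) auto
    finally show "a n powr t \<le> a n powr s * c powr (t - s)" .
  qed
  also have "\<dots> = (\<Sum>n<N. a n powr s) * c powr (t - s)" by (simp add: sum_distrib_right)
  also have "\<dots> \<le> c powr s * c powr (t - s)" by (intro mult_right_mono le) auto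
  also have "\<dots> = c powr t" by (simp flip: powr_add)
  finally show ?thesis .
qed

lemma ell_norm_nonneg [simp]: "0 \<le> vnorm (ell s) x"
  by (simp add: ell_def)

lemma ell_norm_leI:
  fixes x :: "nat \<Rightarrow> 'k::scalar_field"
  assumes "0 < s" "0 \<le> c" "\<And>N. (\<Sum>n<N. norm (x n) powr s) \<le> c powr s"
  shows "x \<in> points (ell s)" "vnorm (ell s) x \<le> c"
  using lp_norm_le_iff[of s c "\<lambda>n. norm (x n)"] assms by (auto simp: ell_def)

lemma ell_sum_le_norm:
  fixes x :: "nat \<Rightarrow> 'k::scalar_field"
  assumes "0 < s" "x \<in> points (ell s)" "finite A"
  shows "(\<Sum>n\<in>A. norm (x n) powr s) \<le> vnorm (ell s) x powr s"
proof -
  have "(\<Sum>n<N. norm (x n) powr s) \<le> vnorm (ell s) x powr s" for N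
    using lp_norm_le_iff[of s "vnorm (ell s) x" "\<lambda>n. norm (x n)"] assms
    by (auto simp: ell_def)
  moreover have "(\<Sum>n\<in>A. norm (x n) powr s) \<le> (\<Sum>n<Suc (Max A). norm (x n) powr s)"
    by (rule sum_mono2) (use assms in \<open>auto simp: less_Suc_eq_le\<close>)
  ultimately show ?thesis by (meson order_trans)
qed

text \<open>
  The block sizes are arbitrary, since besides \<open>ell2_sum\<close> also the block structures produced by
  the approximation of operators below have to be covered.
\<close>

definition block_sum :: "(nat \<Rightarrow> nat) \<Rightarrow> real \<Rightarrow> (nat \<times> nat, 'k::scalar_field) fspace" where
  "block_sum k s = direct_sum s (\<lambda>n. ell2_fin (k n))"

definition block_norm :: "(nat \<Rightarrow> nat) \<Rightarrow> (nat \<times> nat \<Rightarrow> 'k::scalar_field) \<Rightarrow> nat \<Rightarrow> real" where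
  "block_norm k x n = L2_set (\<lambda>i. norm (x (n, i))) {..<k n}"

lemma block_norm_nonneg [simp]: "0 \<le> block_norm k x n"
  by (simp add: block_norm_def L2_set_nonneg)

lemma block_sum_norm_nonneg [simp]: "0 \<le> vnorm (block_sum k s) x"
  by (simp add: block_sum_def direct_sum_def)

lemma block_sum_zero: "x \<in> points (block_sum k s) \<Longrightarrow> k n \<le> i \<Longrightarrow> x (n, i) = 0"
  by (auto simp: block_sum_def direct_sum_def ell2_fin_def)

lemma block_sum_norm_leI:
  fixes x :: "nat \<times> nat \<Rightarrow> 'k::scalar_field"
  assumes "0 < s" "0 \<le> c" "\<And>n i. k n \<le> i \<Longrightarrow> x (n, i) = 0"
    and "\<And>N. (\<Sum>n<N. block_norm k x n powr s) \<le> c powr s"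
  shows "x \<in> points (block_sum k s)" "vnorm (block_sum k s) x \<le> c"
  using lp_norm_le_iff[of s c "block_norm k x"] assms
  by (auto simp: block_sum_def direct_sum_def ell2_fin_def block_norm_def)

lemma block_sum_le_norm:
  fixes x :: "nat \<times> nat \<Rightarrow> 'k::scalar_field"
  assumes "0 < s" "x \<in> points (block_sum k s)"
  shows "(\<Sum>n<N. block_norm k x n powr s) \<le> vnorm (block_sum k s) x powr s"
  using lp_norm_le_iff[of s "vnorm (block_sum k s) x" "block_norm k x"] assms
  by (auto simp: block_sum_def direct_sum_def ell2_fin_def block_norm_def L2_set_nonneg)

section \<open>Bounded operators\<close>

lemma operatorsI:
  assumes "\<And>x. x \<in> points X \<Longrightarrow> T x \<in> points Y"
    and "\<And>x. x \<in> points X \<Longrightarrow> vnorm Y (T x) \<le> C * vnorm X x"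
    and "\<And>x y. x \<in> points X \<Longrightarrow> y \<in> points X \<Longrightarrow> T (\<lambda>i. x i + y i) = (\<lambda>j. T x j + T y j)"
    and "\<And>c x. x \<in> points X \<Longrightarrow> T (\<lambda>i. c * x i) = (\<lambda>j. c * T x j)"
  shows "T \<in> operators X Y"
  using assms unfolding operators_def by blast

lemma operators_closed: "T \<in> operators X Y \<Longrightarrow> x \<in> points X \<Longrightarrow> T x \<in> points Y"
  unfolding operators_def by blast

lemma operators_add:
  "T \<in> operators X Y \<Longrightarrow> x \<in> points X \<Longrightarrow> y \<in> points X \<Longrightarrow> T (\<lambda>i. x i + y i) = (\<lambda>j. T x j + T y j)"
  unfolding operators_def by blast

lemma operators_scale:
  "T \<in> operators X Y \<Longrightarrow> x \<in> points X \<Longrightarrow> T (\<lambda>i. c * x i) = (\<lambda>j. c * T x j)"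
  unfolding operators_def by blast

lemma operators_bound:
  assumes "T \<in> operators X Y" "\<And>x. x \<in> points X \<Longrightarrow> vnorm X x \<ge> 0"
  obtains C where "C \<ge> 0" "\<And>x. x \<in> points X \<Longrightarrow> vnorm Y (T x) \<le> C * vnorm X x"
proof -
  obtain C where C: "\<forall>x\<in>points X. vnorm Y (T x) \<le> C * vnorm X x"
    using assms unfolding operators_def by blast
  have "vnorm Y (T x) \<le> max 0 C * vnorm X x" if "x \<in> points X" for x
    using C that assms(2)[OF that] mult_right_mono[of C "max 0 C" "vnorm X x"] by force
  then show thesis by (intro that[of "max 0 C"]) auto
qed

lemma operators_compose:
  assumes "B \<in> operators X Y" "A \<in> operators Y Z"
    and X: "\<And>x. x \<in> points X \<Longrightarrow> vnorm X x \<ge> 0" and Y: "\<And>y. y \<in> points Y \<Longrightarrow> vnorm Y y \<ge> 0"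
  shows "(\<lambda>x. A (B x)) \<in> operators X Z"
proof -
  obtain C where C: "C \<ge> 0" "\<And>x. x \<in> points X \<Longrightarrow> vnorm Y (B x) \<le> C * vnorm X x"
    using operators_bound[OF assms(1) X] by blast
  obtain D where D: "D \<ge> 0" "\<And>y. y \<in> points Y \<Longrightarrow> vnorm Z (A y) \<le> D * vnorm Y y"
    using operators_bound[OF assms(2) Y] by blast
  note maps = operators_closed[OF assms(1)]
  show ?thesis
  proof (rule operatorsI[of _ _ _ "D * C"])
    fix x assume x: "x \<in> points X"
    have "vnorm Z (A (B x)) \<le> D * vnorm Y (B x)" using D maps x by blast
    also have "\<dots> \<le> D * (C * vnorm X x)" using C D x by (intro mult_left_mono) auto
    finally show "vnorm Z (A (B x)) \<le> D * C * vnorm X x" by simp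
  qed (simp_all only: maps operators_closed[OF assms(2)] operators_add[OF assms(1)]
      operators_add[OF assms(2)] operators_scale[OF assms(1)] operators_scale[OF assms(2)])
qed

section \<open>Block sums are complemented in sequence spaces\<close>

lemma block_sum_inclusion:
  assumes "0 < s" "s \<le> t"
  shows "(\<lambda>x. x) \<in> operators (block_sum k s) (block_sum k t :: (_, 'k::scalar_field) fspace)"
proof (rule operatorsI[of _ _ _ 1])
  fix x :: "nat \<times> nat \<Rightarrow> 'k" assume x: "x \<in> points (block_sum k s)"
  have *: "(\<Sum>n<N. block_norm k x n powr t) \<le> vnorm (block_sum k s) x powr t" for N
    by (rule lp_norm_mono[OF assms]) (simp_all add: block_sum_le_norm[OF assms(1) x])
  show "x \<in> points (block_sum k t)" "vnorm (block_sum k t) x \<le> 1 * vnorm (block_sum k s) x"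
    using block_sum_norm_leI[OF less_le_trans[OF assms] block_sum_norm_nonneg block_sum_zero[OF x] *]
    by simp_all
qed simp_all

text \<open>
  The \<open>n\<close>-th block is sent to its Rademacher sums in \<open>\<ell>\<^sub>r\<close> of dimension \<open>2 ^ k n\<close>, normalised by
  the weight \<open>w n\<close> so that sums over \<open>{..<2 ^ k n}\<close> become averages, and it is recovered by
  taking Rademacher coefficients. By Khintchine's inequality and its adjoint, the norms of these maps
  are bounded independently of the block sizes, so they can be put side by side. The pairing
  function lays out the blocks in a single sequence.
\<close>

lemma block_sum_complemented:
  fixes k :: "nat \<Rightarrow> nat"
  assumes "1 < r"
  obtains J Q where
    "J \<in> operators (block_sum k r) (ell r :: (nat, 'k::scalar_field) fspace)"
    "Q \<in> operators (ell r :: (nat, 'k) fspace) (block_sum k r)"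
    "\<And>x. x \<in> points (block_sum k r :: (nat \<times> nat, 'k) fspace) \<Longrightarrow> Q (J x) = x"
proof -
  define w where "w n = 2 powr (- real (k n) / r)" for n
  have w: "w n > 0" "w n powr r = 1 / 2 ^ k n" for n
    using assms by (auto simp: w_def powr_powr powr_divide powr_minus_divide powr_realpow)
  define J :: "(nat \<times> nat \<Rightarrow> 'k) \<Rightarrow> nat \<Rightarrow> 'k" where
    "J x m = (case prod_decode m of (n, j) \<Rightarrow>
       if j < 2 ^ k n then w n *\<^sub>R (\<Sum>i<k n. rademacher i j *\<^sub>R x (n, i)) else 0)" for x m
  define Q :: "(nat \<Rightarrow> 'k) \<Rightarrow> nat \<times> nat \<Rightarrow> 'k" where
    "Q f = (\<lambda>(n, i). if i < k n
       then (\<Sum>j<2 ^ k n. rademacher i j *\<^sub>R (f (prod_encode (n, j)) /\<^sub>R w n)) /\<^sub>R 2 ^ k n else 0)" for f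
  define F where "F n = (\<lambda>j. prod_encode (n, j)) ` {..<2 ^ k n}" for n
  have F: "finite (F n)" "n \<noteq> n' \<Longrightarrow> F n \<inter> F n' = {}" for n n'
    by (auto simp: F_def)
  have sum_F: "(\<Sum>m\<in>F n. g m) = (\<Sum>j<2 ^ k n. g (prod_encode (n, j)))" for g :: "nat \<Rightarrow> real" and n
    by (simp add: F_def sum.reindex inj_on_def)
  have sum_blocks: "(\<Sum>m\<in>(\<Union>n\<in>{..<N}. F n). g m) = (\<Sum>n<N. \<Sum>j<2 ^ k n. g (prod_encode (n, j)))"
    for g :: "nat \<Rightarrow> real" and N
    using F by (subst sum.UNION_disjoint) (auto simp: sum_F)
  obtain K where K: "K \<ge> 0" "\<And>n (a :: nat \<Rightarrow> 'k).
     (\<Sum>j<2 ^ n. norm (\<Sum>i<n. rademacher i j *\<^sub>R a i) powr r)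
        \<le> K * 2 ^ n * L2_set (\<lambda>i. norm (a i)) {..<n} powr r"
    using khintchine[of r, where 'a='k] assms by auto
  obtain L where L: "L \<ge> 0" "\<And>n (f :: nat \<Rightarrow> 'k).
     L2_set (\<lambda>i. norm ((\<Sum>j<2 ^ n. rademacher i j *\<^sub>R f j) /\<^sub>R 2 ^ n)) {..<n} powr r
        \<le> L * ((\<Sum>j<2 ^ n. norm (f j) powr r) / 2 ^ n)"
    using rademacher_coefficients_bound[of r, where 'a='k] assms by auto
  have J_bound: "J x \<in> points (ell r)" "vnorm (ell r) (J x) \<le> K powr (1 / r) * vnorm (block_sum k r) x"
    if x: "x \<in> points (block_sum k r)" for x
  proof -
    have *: "(\<Sum>m<N. norm (J x m) powr r) \<le> (K powr (1 / r) * vnorm (block_sum k r) x) powr r" for N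
    proof -
      have "(\<Sum>m<N. norm (J x m) powr r) = (\<Sum>m\<in>{..<N} \<inter> (\<Union>n\<in>{..<N}. F n). norm (J x m) powr r)"
      proof (rule sum.mono_neutral_right)
        show "\<forall>m\<in>{..<N} - {..<N} \<inter> (\<Union>n\<in>{..<N}. F n). norm (J x m) powr r = 0"
        proof
          fix m assume m: "m \<in> {..<N} - {..<N} \<inter> (\<Union>n\<in>{..<N}. F n)"
          obtain n j where nj: "prod_decode m = (n, j)" by fastforce
          then have enc: "m = prod_encode (n, j)" by (metis prod_decode_inverse)
          have "n \<le> m" using le_prod_encode_1 enc by metis
          then have "n < N" using m by auto
          then have "\<not> j < 2 ^ k n" using m enc by (auto simp: F_def)
          then show "norm (J x m) powr r = 0" by (simp add: J_def nj)
        qed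
      qed auto
      also have "\<dots> \<le> (\<Sum>m\<in>(\<Union>n\<in>{..<N}. F n). norm (J x m) powr r)"
        using F by (intro sum_mono2) auto
      also have "\<dots> = (\<Sum>n<N. \<Sum>j<2 ^ k n. norm (J x (prod_encode (n, j))) powr r)"
        by (rule sum_blocks)
      also have "\<dots> \<le> (\<Sum>n<N. K * block_norm k x n powr r)"
      proof (rule sum_mono)
        fix n
        have "(\<Sum>j<2 ^ k n. norm (J x (prod_encode (n, j))) powr r)
            = (\<Sum>j<2 ^ k n. norm (\<Sum>i<k n. rademacher i j *\<^sub>R x (n, i)) powr r) / 2 ^ k n"
          unfolding sum_divide_distrib
          by (rule sum.cong) (use w in \<open>auto simp: J_def powr_mult less_imp_le\<close>)
        also have "\<dots> \<le> (K * 2 ^ k n * block_norm k x n powr r) / 2 ^ k n"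
          unfolding block_norm_def by (intro divide_right_mono K) auto
        finally show "(\<Sum>j<2 ^ k n. norm (J x (prod_encode (n, j))) powr r) \<le> K * block_norm k x n powr r"
          by simp
      qed
      also have "\<dots> \<le> K * vnorm (block_sum k r) x powr r"
        unfolding sum_distrib_left[symmetric] using K(1) assms x
        by (intro mult_left_mono block_sum_le_norm) auto
      also have "\<dots> = (K powr (1 / r) * vnorm (block_sum k r) x) powr r"
        using K(1) assms by (simp add: powr_mult powr_powr)
      finally show ?thesis .
    qed
    show "J x \<in> points (ell r)" "vnorm (ell r) (J x) \<le> K powr (1 / r) * vnorm (block_sum k r) x"
      using ell_norm_leI[OF _ _ *] assms by auto
  qed
  have Q_bound: "Q f \<in> points (block_sum k r)" "vnorm (block_sum k r) (Q f) \<le> L powr (1 / r) * vnorm (ell r) f"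
    if f: "f \<in> points (ell r)" for f
  proof -
    have *: "(\<Sum>n<N. block_norm k (Q f) n powr r) \<le> (L powr (1 / r) * vnorm (ell r) f) powr r" for N
    proof -
      have "(\<Sum>n<N. block_norm k (Q f) n powr r) \<le>
          (\<Sum>n<N. L * (\<Sum>j<2 ^ k n. norm (f (prod_encode (n, j))) powr r))"
      proof (rule sum_mono)
        fix n
        have "block_norm k (Q f) n powr r
           \<le> L * ((\<Sum>j<2 ^ k n. norm (f (prod_encode (n, j)) /\<^sub>R w n) powr r) / 2 ^ k n)"
          using L(2)[where n="k n" and f="\<lambda>j. f (prod_encode (n, j)) /\<^sub>R w n"]
          unfolding block_norm_def Q_def by (simp cong: L2_set_cong_simp del: scaleR_scaleR norm_scaleR)
        also have "(\<Sum>j<2 ^ k n. norm (f (prod_encode (n, j)) /\<^sub>R w n) powr r)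
           = (\<Sum>j<2 ^ k n. norm (f (prod_encode (n, j))) powr r * 2 ^ k n)"
        proof (rule sum.cong)
          fix j
          have "norm (f (prod_encode (n, j)) /\<^sub>R w n) = norm (f (prod_encode (n, j))) / w n"
            using w(1)[of n] by (simp add: divide_inverse mult.commute)
          then show "norm (f (prod_encode (n, j)) /\<^sub>R w n) powr r = norm (f (prod_encode (n, j))) powr r * 2 ^ k n"
            using w[of n] by (simp add: powr_divide)
        qed simp
        finally show "block_norm k (Q f) n powr r \<le> L * (\<Sum>j<2 ^ k n. norm (f (prod_encode (n, j))) powr r)"
          by (simp flip: sum_distrib_right)
      qed
      also have "\<dots> = L * (\<Sum>m\<in>(\<Union>n\<in>{..<N}. F n). norm (f m) powr r)"
        by (simp add: sum_blocks sum_distrib_left)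
      also have "\<dots> \<le> L * vnorm (ell r) f powr r"
        using L(1) assms F f by (intro mult_left_mono ell_sum_le_norm) auto
      also have "\<dots> = (L powr (1 / r) * vnorm (ell r) f) powr r"
        using L(1) assms by (simp add: powr_mult powr_powr)
      finally show ?thesis .
    qed
    show "Q f \<in> points (block_sum k r)" "vnorm (block_sum k r) (Q f) \<le> L powr (1 / r) * vnorm (ell r) f"
      using block_sum_norm_leI[OF _ _ _ *] assms by (auto simp: Q_def)
  qed
  show thesis
  proof (rule that[of J Q])
    show "J \<in> operators (block_sum k r) (ell r)"
    proof (rule operatorsI[of _ _ _ "K powr (1 / r)"])
      fix x y :: "nat \<times> nat \<Rightarrow> 'k"
      show "J (\<lambda>i. x i + y i) = (\<lambda>j. J x j + J y j)"
        by (auto simp: J_def fun_eq_iff scaleR_add_right sum.distrib split: prod.split)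
    next
      fix c and x :: "nat \<times> nat \<Rightarrow> 'k"
      show "J (\<lambda>i. c * x i) = (\<lambda>j. c * J x j)"
        by (auto simp: J_def fun_eq_iff sum_distrib_left split: prod.split)
    qed (use J_bound in auto)
    show "Q \<in> operators (ell r) (block_sum k r)"
    proof (rule operatorsI[of _ _ _ "L powr (1 / r)"])
      fix x y :: "nat \<Rightarrow> 'k"
      show "Q (\<lambda>i. x i + y i) = (\<lambda>j. Q x j + Q y j)"
        by (auto simp: Q_def fun_eq_iff scaleR_add_right sum.distrib)
    next
      fix c and x :: "nat \<Rightarrow> 'k"
      show "Q (\<lambda>i. c * x i) = (\<lambda>j. c * Q x j)"
        by (auto simp: Q_def fun_eq_iff sum_distrib_left)
    qed (use Q_bound in auto)
    fix x :: "nat \<times> nat \<Rightarrow> 'k" assume x: "x \<in> points (block_sum k r)"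
    show "Q (J x) = x"
    proof
      fix ni :: "nat \<times> nat"
      obtain n i where ni: "ni = (n, i)" by (rule prod.exhaust)
      show "Q (J x) ni = x ni"
      proof (cases "i < k n")
        case False
        then show ?thesis using block_sum_zero[OF x] by (simp add: Q_def ni)
      next
        case True
        have "(\<Sum>j<2 ^ k n. rademacher i j *\<^sub>R (J x (prod_encode (n, j)) /\<^sub>R w n))
          = (\<Sum>j<2 ^ k n. \<Sum>l<k n. (rademacher i j * rademacher l j) *\<^sub>R x (n, l))"
          using w(1)[of n] by (intro sum.cong) (auto simp: J_def scaleR_sum_right field_simps)
        also have "\<dots> = (\<Sum>l<k n. (\<Sum>j<2 ^ k n. rademacher i j * rademacher l j) *\<^sub>R x (n, l))"
          by (subst sum.swap) (simp add: scaleR_sum_left)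
        also have "\<dots> = (\<Sum>l<k n. if l = i then (2 ^ k n) *\<^sub>R x (n, l) else 0)"
          using True rademacher_orthogonal[of i "k n"] by (intro sum.cong) auto
        also have "\<dots> = (2 ^ k n) *\<^sub>R x (n, i)"
          using True by simp
        finally show ?thesis using True by (simp add: Q_def ni)
      qed
    qed
  qed
qed

text \<open>
  The formal identity passes through the block sum with exponent \<open>r\<close>, and the identity of that
  space factors through \<open>\<ell>\<^sub>r\<close> because the space is complemented there.
\<close>

lemma block_sum_identity_factors:
  assumes "0 < s" "s \<le> r" "1 < r" "r \<le> t"
  obtains J Q where
    "J \<in> operators (block_sum k s) (ell r :: (nat, 'k::scalar_field) fspace)"
    "Q \<in> operators (ell r :: (nat, 'k) fspace) (block_sum k t)"
    "\<And>x. x \<in> points (block_sum k s :: (nat \<times> nat, 'k) fspace) \<Longrightarrow> Q (J x) = x"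
proof -
  obtain J :: "(nat \<times> nat \<Rightarrow> 'k) \<Rightarrow> nat \<Rightarrow> 'k" and Q where
    J: "J \<in> operators (block_sum k r) (ell r)" and Q: "Q \<in> operators (ell r) (block_sum k r)"
    and QJ: "\<And>x. x \<in> points (block_sum k r) \<Longrightarrow> Q (J x) = x"
    using block_sum_complemented[OF assms(3), of k, where 'k='k] by blast
  have i: "(\<lambda>x. x) \<in> operators (block_sum k s) (block_sum k r :: (_, 'k) fspace)"
    using assms by (intro block_sum_inclusion)
  show thesis
  proof (rule that[of J Q])
    show "J \<in> operators (block_sum k s) (ell r)"
      using operators_compose[OF i J] by simp
    have "(\<lambda>x. x) \<in> operators (block_sum k r) (block_sum k t :: (_, 'k) fspace)"
      using assms by (intro block_sum_inclusion) auto
    from operators_compose[OF Q this] show "Q \<in> operators (ell r) (block_sum k t)"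
      by simp
    show "Q (J x) = x" if "x \<in> points (block_sum k s)" for x
      using QJ operators_closed[OF i that] by blast
  qed
qed

lemma pelczynski_factors:
  assumes "0 < p" "p \<le> r" "1 < r" "r \<le> q" 
    and "T \<in> (pelczynski_operators p q :: ((nat \<Rightarrow> 'k::scalar_field) \<Rightarrow> (nat \<Rightarrow> 'k)) set)"
  shows "factors_through (ell r) (ell p) (ell q) T"
proof -
  have block: "ell2_sum s = (block_sum Suc s :: (_, 'k) fspace)" for s
    unfolding ell2_sum_def block_sum_def ..
  obtain U V where U: "U \<in> operators (ell p) (block_sum Suc p)"
    and V: "V \<in> operators (block_sum Suc q) (ell q)"
    and T: "\<forall>x\<in>points (ell p). T x = V (U x)"
  proof -
    obtain U V where "U \<in> isomorphisms (ell p) (ell2_sum p)" "V \<in> isomorphisms (ell2_sum q) (ell q)"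
      "\<forall>x\<in>points (ell p). T x = V (id (U x))"
      using assms(5) unfolding pelczynski_operators_def by blast
    then show ?thesis
      by (intro that[of U V]) (simp_all add: isomorphisms_def block)
  qed
  obtain J :: "(nat \<times> nat \<Rightarrow> 'k) \<Rightarrow> nat \<Rightarrow> 'k" and Q where
    J: "J \<in> operators (block_sum Suc p) (ell r)" and Q: "Q \<in> operators (ell r) (block_sum Suc q)"
    and QJ: "\<And>x. x \<in> points (block_sum Suc p) \<Longrightarrow> Q (J x) = x"
    using block_sum_identity_factors[OF assms(1-4), of Suc, where 'k='k] by blast
  have "T x = V (Q (J (U x)))" if "x \<in> points (ell p)" for x
    using that T QJ operators_closed[OF U that] by simp
  then show ?thesis
    unfolding factors_through_def
    using operators_compose[OF U J] operators_compose[OF Q V] by auto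
qed

section \<open>Coordinate restrictions and tails\<close>

text \<open>
  The constant \<open>2\<close> comes from bounding each coordinate of the sum by twice the larger summand; it
  does no harm to boundedness or to approximation up to arbitrarily small errors.
\<close>

lemma ell_add:
  fixes x y :: "nat \<Rightarrow> 'k::scalar_field"
  assumes "1 \<le> s" "x \<in> points (ell s)" "y \<in> points (ell s)"
  shows "(\<lambda>i. x i + y i) \<in> points (ell s)"
    and "vnorm (ell s) (\<lambda>i. x i + y i) \<le> 2 * (vnorm (ell s) x + vnorm (ell s) y)"
proof -
  let ?X = "vnorm (ell s) x" and ?Y = "vnorm (ell s) y"
  have *: "(\<Sum>n<N. norm (x n + y n) powr s) \<le> (2 * (?X + ?Y)) powr s" for N
  proof -
    have pointwise: "norm (x n + y n) powr s \<le> 2 powr s * (norm (x n) powr s + norm (y n) powr s)" for n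
    proof -
      have "norm (x n + y n) powr s \<le> (\<Sum>b\<in>UNIV. if b then norm (x n) else norm (y n)) powr s"
        using assms by (intro powr_mono2) (auto simp: UNIV_bool add.commute norm_triangle_ineq)
      also have "\<dots> \<le> real (card (UNIV :: bool set)) powr s *
          (\<Sum>b\<in>UNIV. (if b then norm (x n) else norm (y n)) powr s)"
        using assms by (intro powr_sum_le) auto
      finally show ?thesis by (simp add: UNIV_bool add.commute)
    qed
    have superadditive: "a powr s + b powr s \<le> (a + b) powr s" if "a \<ge> 0" "b \<ge> 0" for a b :: real
    proof -
      have split: "c powr s = c * c powr (s - 1)" if "c \<ge> 0" for c :: real
        using that powr_mult_base[of c "s - 1"] by simp
      have "a powr s + b powr s \<le> a * (a + b) powr (s - 1) + b * (a + b) powr (s - 1)"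
        unfolding split[OF that(1)] split[OF that(2)]
        using that assms by (intro add_mono mult_left_mono powr_mono2) auto
      also have "\<dots> = (a + b) powr s" using split[of "a + b"] that by (simp add: distrib_right)
      finally show ?thesis .
    qed
    have "(\<Sum>n<N. norm (x n + y n) powr s)
        \<le> 2 powr s * ((\<Sum>n<N. norm (x n) powr s) + (\<Sum>n<N. norm (y n) powr s))"
      unfolding sum.distrib[symmetric] sum_distrib_left by (intro sum_mono pointwise)
    also have "\<dots> \<le> 2 powr s * (?X powr s + ?Y powr s)"
      using assms by (intro mult_left_mono add_mono ell_sum_le_norm) auto
    also have "\<dots> \<le> 2 powr s * (?X + ?Y) powr s"
      by (intro mult_left_mono superadditive) auto
    also have "\<dots> = (2 * (?X + ?Y)) powr s" by (rule powr_mult[symmetric])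
    finally show ?thesis .
  qed
  show "(\<lambda>i. x i + y i) \<in> points (ell s)"
    "vnorm (ell s) (\<lambda>i. x i + y i) \<le> 2 * (?X + ?Y)"
    using ell_norm_leI[OF _ _ *] assms by auto
qed

lemma ell_scale:
  fixes x :: "nat \<Rightarrow> 'k::scalar_field"
  assumes "0 < s" "x \<in> points (ell s)"
  shows "(\<lambda>i. c * x i) \<in> points (ell s)"
    and "vnorm (ell s) (\<lambda>i. c * x i) \<le> norm c * vnorm (ell s) x"
proof -
  have *: "(\<Sum>n<N. norm (c * x n) powr s) \<le> (norm c * vnorm (ell s) x) powr s" for N
    using ell_sum_le_norm[OF assms, of "{..<N}"]
    by (simp add: norm_mult powr_mult sum_distrib_left[symmetric] mult_left_mono)
  show "(\<lambda>i. c * x i) \<in> points (ell s)"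
    "vnorm (ell s) (\<lambda>i. c * x i) \<le> norm c * vnorm (ell s) x"
    using ell_norm_leI[OF _ _ *] assms by auto
qed

lemma ell_diff:
  fixes x y :: "nat \<Rightarrow> 'k::scalar_field"
  assumes "1 \<le> s" "x \<in> points (ell s)" "y \<in> points (ell s)"
  shows "(\<lambda>i. x i - y i) \<in> points (ell s)"
    and "vnorm (ell s) (\<lambda>i. x i - y i) \<le> 2 * (vnorm (ell s) x + vnorm (ell s) y)"
proof -
  have y: "(\<lambda>i. (- 1) * y i) \<in> points (ell s)"
    "vnorm (ell s) (\<lambda>i. (- 1) * y i) \<le> vnorm (ell s) y"
    using ell_scale[of s y "- 1"] assms by auto
  show "(\<lambda>i. x i - y i) \<in> points (ell s)"
    using ell_add(1)[OF assms(1,2) y(1)] by simp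
  show "vnorm (ell s) (\<lambda>i. x i - y i) \<le> 2 * (vnorm (ell s) x + vnorm (ell s) y)"
    using ell_add(2)[OF assms(1,2) y(1)] y(2) by simp
qed

lemma operators_diff:
  fixes x y :: "nat \<Rightarrow> 'k::scalar_field"
  assumes "T \<in> operators (ell s) Y" "1 \<le> s" "x \<in> points (ell s)" "y \<in> points (ell s)"
  shows "T (\<lambda>i. x i - y i) = (\<lambda>j. T x j - T y j)"
  using operators_add[OF assms(1) ell_diff(1)[OF assms(2-4)] assms(4)]
  by (auto simp: fun_eq_iff)

definition restr :: "nat set \<Rightarrow> (nat \<Rightarrow> 'k) \<Rightarrow> nat \<Rightarrow> 'k::zero" where
  "restr E x i = (if i \<in> E then x i else 0)"

lemma sum_restr_powr:
  "(\<Sum>i\<in>A. norm (restr E x i) powr s) = (\<Sum>i\<in>A \<inter> E. norm (x i :: 'a::real_normed_vector) powr s)"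
  if "finite A"
  using that by (intro sum.mono_neutral_cong_right) (auto simp: restr_def)

lemma ell_restr:
  fixes x :: "nat \<Rightarrow> 'k::scalar_field"
  assumes "0 < s" "x \<in> points (ell s)"
  shows "restr E x \<in> points (ell s)" and "vnorm (ell s) (restr E x) \<le> vnorm (ell s) x"
  using ell_norm_leI[OF assms(1) ell_norm_nonneg, of "restr E x" s x] assms
  by (simp_all add: sum_restr_powr ell_sum_le_norm)

lemma ell_restr_finite:
  fixes x :: "nat \<Rightarrow> 'k::scalar_field"
  assumes "0 < s" "finite E"
  shows "restr E x \<in> points (ell s)" and "vnorm (ell s) (restr E x) powr s \<le> (\<Sum>i\<in>E. norm (x i) powr s)"
proof -
  let ?S = "\<Sum>i\<in>E. norm (x i) powr s"
  have S: "?S \<ge> 0" by (simp add: sum_nonneg)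
  have *: "(\<Sum>n<N. norm (restr E x n) powr s) \<le> (?S powr (1 / s)) powr s" for N
    using assms S by (simp add: sum_restr_powr powr_powr) (intro sum_mono2, auto)
  have "restr E x \<in> points (ell s) \<and> vnorm (ell s) (restr E x) \<le> ?S powr (1 / s)"
    using ell_norm_leI[OF _ _ *] assms by auto
  then show "restr E x \<in> points (ell s)" "vnorm (ell s) (restr E x) powr s \<le> ?S"
    using powr_mono2[of s "vnorm (ell s) (restr E x)" "?S powr (1 / s)"] assms S
    by (auto simp: powr_powr)
qed

lemma restr_add: "restr E (\<lambda>i. x i + y i) = (\<lambda>i. restr E x i + restr E y i)"
  for x y :: "nat \<Rightarrow> 'a::monoid_add"
  by (auto simp: restr_def)

lemma restr_scale: "restr E (\<lambda>i. c * x i) = (\<lambda>i. c * restr E x i)"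
  for x :: "nat \<Rightarrow> 'a::mult_zero"
  by (auto simp: restr_def)

lemma summable_tail_small:
  fixes f :: "nat \<Rightarrow> real"
  assumes "summable f" "\<And>n. f n \<ge> 0" "0 < e"
  obtains m where "\<And>A. finite A \<Longrightarrow> A \<subseteq> {m..} \<Longrightarrow> sum f A \<le> e"
proof -
  obtain m where m: "\<And>i. i \<ge> m \<Longrightarrow> norm (\<Sum>n. f (n + i)) < e"
    using suminf_exist_split[OF assms(3,1)] by auto
  have "sum f A \<le> e" if A: "finite A" "A \<subseteq> {m..}" for A
  proof -
    have "sum f A = (\<Sum>n\<in>(\<lambda>n. n - m) ` A. f (n + m))"
      using A by (subst sum.reindex) (auto simp: inj_on_def subset_iff eq_diff_iff)
    also have "\<dots> \<le> (\<Sum>n. f (n + m))"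
      using A assms by (intro sum_le_suminf) (auto simp: summable_iff_shift)
    finally show ?thesis using m[of m] by simp
  qed
  then show thesis by (rule that)
qed

lemma ell_tail_small:
  fixes x :: "nat \<Rightarrow> 'k::scalar_field"
  assumes "0 < s" "x \<in> points (ell s)" "0 < e"
  obtains N where "vnorm (ell s) (restr {N..} x) \<le> e"
proof -
  have "summable (\<lambda>n. norm (x n) powr s)" using assms by (simp add: ell_def)
  from summable_tail_small[OF this, of "e powr s"] assms
  obtain m where m: "\<And>A. finite A \<Longrightarrow> A \<subseteq> {m..} \<Longrightarrow> (\<Sum>n\<in>A. norm (x n) powr s) \<le> e powr s"
    by auto
  have "vnorm (ell s) (restr {m..} x) \<le> e"
    by (rule ell_norm_leI) (use assms m in \<open>auto simp: sum_restr_powr\<close>)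
  then show thesis by (rule that)
qed

definition unit_vector :: "nat \<Rightarrow> nat \<Rightarrow> 'k::zero_neq_one" where
  "unit_vector l i = (if i = l then 1 else 0)"

lemma unit_vector_in_ell: "0 < s \<Longrightarrow> (unit_vector l :: nat \<Rightarrow> 'k::scalar_field) \<in> points (ell s)"
  using ell_restr_finite(1)[of s "{l}" "\<lambda>_. 1"]
  by (simp add: restr_def[abs_def] unit_vector_def[abs_def])

lemma operator_on_initial_segment:
  fixes x :: "nat \<Rightarrow> 'k::scalar_field"
  assumes T: "T \<in> operators (ell s) Y" and "0 < s"
  shows "T (restr {..<N} x) = (\<lambda>j. \<Sum>l<N. x l * T (unit_vector l) j)"
proof (induction N)
  case 0
  have "T (\<lambda>i. 0 * unit_vector 0 i) = (\<lambda>j. 0 * T (unit_vector 0) j)"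
    using assms by (intro operators_scale[OF T] unit_vector_in_ell)
  then show ?case by (simp add: restr_def[abs_def])
next
  case (Suc N)
  have in_ell: "(\<lambda>i. x N * unit_vector N i) \<in> points (ell s)"
    using assms by (intro ell_scale unit_vector_in_ell)
  have split: "restr {..<Suc N} x = (\<lambda>i. restr {..<N} x i + x N * unit_vector N i)"
    by (auto simp: restr_def unit_vector_def fun_eq_iff less_Suc_eq)
  have "T (restr {..<Suc N} x) = (\<lambda>j. T (restr {..<N} x) j + T (\<lambda>i. x N * unit_vector N i) j)"
    unfolding split using assms by (intro operators_add[OF T] ell_restr_finite(1) in_ell) auto
  also have "T (\<lambda>i. x N * unit_vector N i) = (\<lambda>j. x N * T (unit_vector N) j)"
    using assms by (intro operators_scale[OF T] unit_vector_in_ell)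
  finally show ?case by (simp add: Suc)
qed

lemma coordinate_le_norm:
  fixes x :: "nat \<Rightarrow> 'k::scalar_field"
  assumes "0 < s" "x \<in> points (ell s)"
  shows "norm (x k) \<le> vnorm (ell s) x"
proof (rule ccontr)
  assume "\<not> norm (x k) \<le> vnorm (ell s) x"
  then have "vnorm (ell s) x powr s < norm (x k) powr s"
    using assms by (intro powr_less_mono2) auto
  moreover have "norm (x k) powr s \<le> vnorm (ell s) x powr s"
    using ell_sum_le_norm[OF assms, of "{k}"] by simp
  ultimately show False by simp
qed

text \<open>
  The vectors supported in \<open>{..<m}\<close> span a finite-dimensional space. Their images are
  combinations of the finitely many columns \<open>S (unit_vector l)\<close>, whose tails are small, and the
  coefficients are bounded by the norm.
\<close>

lemma columns_tail:
  fixes S :: "(nat \<Rightarrow> 'k::scalar_field) \<Rightarrow> nat \<Rightarrow> 'k"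
  assumes S: "S \<in> operators (ell s) (ell t)" and "0 < s" "0 < t" "0 < e"
  obtains n where "\<And>x A. x \<in> points (ell s) \<Longrightarrow> (\<And>i. m \<le> i \<Longrightarrow> x i = 0) \<Longrightarrow> finite A \<Longrightarrow> A \<subseteq> {n..} \<Longrightarrow>
     (\<Sum>k\<in>A. norm (S x k) powr t) \<le> (e * vnorm (ell s) x) powr t"
proof -
  define h where "h k = real m powr t * (\<Sum>l<m. norm (S (unit_vector l) k) powr t)" for k
  have "summable h"
    unfolding h_def
    using operators_closed[OF S unit_vector_in_ell[OF assms(2)]]
    by (intro summable_mult summable_sum) (simp add: ell_def)
  moreover have "h k \<ge> 0" for k by (simp add: h_def sum_nonneg)
  ultimately obtain n where n: "\<And>A. finite A \<Longrightarrow> A \<subseteq> {n..} \<Longrightarrow> sum h A \<le> e powr t"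
    using summable_tail_small[of h "e powr t"] assms by auto
  show thesis
  proof (rule that[of n])
    fix x :: "nat \<Rightarrow> 'k" and A
    assume x: "x \<in> points (ell s)" "\<And>i. m \<le> i \<Longrightarrow> x i = 0" and A: "finite A" "A \<subseteq> {n..}"
    let ?V = "vnorm (ell s) x"
    have "restr {..<m} x = x" using x(2) by (force simp: restr_def)
    then have Sx: "S x = (\<lambda>j. \<Sum>l<m. x l * S (unit_vector l) j)"
      using operator_on_initial_segment[OF S assms(2), of m x] by simp
    have "norm (S x k) powr t \<le> ?V powr t * h k" for k
    proof -
      have "norm (S x k) \<le> (\<Sum>l<m. norm (x l * S (unit_vector l) k))"
        unfolding Sx by (rule norm_sum)
      also have "\<dots> \<le> (\<Sum>l<m. ?V * norm (S (unit_vector l) k))"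
        unfolding norm_mult using x assms by (intro sum_mono mult_right_mono coordinate_le_norm) auto
      also have "\<dots> = ?V * (\<Sum>l<m. norm (S (unit_vector l) k))" by (simp add: sum_distrib_left)
      finally have "norm (S x k) powr t \<le> (?V * (\<Sum>l<m. norm (S (unit_vector l) k))) powr t"
        using assms by (intro powr_mono2) auto
      also have "\<dots> = ?V powr t * (\<Sum>l<m. norm (S (unit_vector l) k)) powr t"
        by (simp add: powr_mult sum_nonneg)
      also have "\<dots> \<le> ?V powr t * h k"
        unfolding h_def using powr_sum_le[of "{..<m}" t "\<lambda>l. norm (S (unit_vector l) k)"] assms
        by (intro mult_left_mono) auto
      finally show ?thesis .
    qed
    then have "(\<Sum>k\<in>A. norm (S x k) powr t) \<le> (\<Sum>k\<in>A. ?V powr t * h k)"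
      by (rule sum_mono)
    also have "\<dots> \<le> ?V powr t * e powr t"
      unfolding sum_distrib_left[symmetric] by (intro mult_left_mono n A) auto
    also have "\<dots> = (e * ?V) powr t" using assms by (simp add: powr_mult mult.commute)
    finally show "(\<Sum>k\<in>A. norm (S x k) powr t) \<le> (e * ?V) powr t" .
  qed
qed

text \<open>
  The \<open>k\<close>-th coordinate of \<open>S\<close> is a bounded functional on \<open>\<ell>\<^sub>s\<close>. For \<open>s > 1\<close> its coefficients \<open>b\<close>
  are summable to the conjugate power, as one sees by testing the functional on finitely supported
  vectors for which Hoelder's inequality is an equality; Hoelder's inequality then bounds it on vectors with late
  support by a tail of \<open>b\<close>. For \<open>s = 1\<close> this is false: the sum of all coordinates is bounded.
\<close>

lemma row_tail:
  fixes S :: "(nat \<Rightarrow> 'k::scalar_field) \<Rightarrow> nat \<Rightarrow> 'k"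
  assumes S: "S \<in> operators (ell s) (ell t)" and s: "1 < s" and t: "0 < t" and "0 < e"
  obtains m where "\<And>x. x \<in> points (ell s) \<Longrightarrow> (\<And>i. i < m \<Longrightarrow> x i = 0) \<Longrightarrow>
     norm (S x k) \<le> e * vnorm (ell s) x"
proof -
  define s' where "s' = s / (s - 1)"
  have s': "s' > 1" "1 / s' + 1 / s = 1" "(s' - 1) * s = s'"
    using s by (auto simp: s'_def field_simps)
  define b where "b l = S (unit_vector l) k" for l
  obtain C where C: "C \<ge> 0" "\<And>x. x \<in> points (ell s) \<Longrightarrow> vnorm (ell t) (S x) \<le> C * vnorm (ell s) x"
    using operators_bound[OF S] by auto
  have bound: "norm (S x k) \<le> C * vnorm (ell s) x" if "x \<in> points (ell s)" for x
    using coordinate_le_norm[OF t operators_closed[OF S that], of k] C(2)[OF that] by simp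
  have expand: "S (restr {..<N} x) k = (\<Sum>l<N. x l * b l)" for N x
    using operator_on_initial_segment[OF S, of N x] s by (simp add: b_def)
  have b_bound: "(\<Sum>l<N. norm (b l) powr s') \<le> C powr s'" for N
  proof -
    let ?A = "\<Sum>l<N. norm (b l) powr s'"
    have A0: "?A \<ge> 0" by (simp add: sum_nonneg)
    \<comment> \<open>The extremal sequence of Hoelder's inequality; where \<open>b l = 0\<close> it vanishes by division by zero.\<close>
    define z where "z l = of_real (norm (b l) powr s') / b l" for l
    have z_norm: "norm (z l) powr s = norm (b l) powr s'" for l
    proof (cases "b l = 0")
      case False
      then have "norm (z l) = norm (b l) powr (s' - 1)"
        by (simp add: z_def norm_divide powr_diff)
      then show ?thesis by (simp add: powr_powr s')
    qed (use s in \<open>simp add: z_def\<close>)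
    have "of_real ?A = S (restr {..<N} z) k"
      unfolding expand of_real_sum by (intro sum.cong) (auto simp: z_def)
    then have "?A \<le> C * vnorm (ell s) (restr {..<N} z)"
      using bound[of "restr {..<N} z"] ell_restr_finite(1)[of s "{..<N}" z] s A0
      by (metis (no_types, lifting) abs_of_nonneg dual_order.strict_trans finite_lessThan norm_of_real zero_less_one)
    also have "vnorm (ell s) (restr {..<N} z) \<le> ?A powr (1 / s)"
    proof -
      have "vnorm (ell s) (restr {..<N} z) powr s \<le> ?A"
        using ell_restr_finite(2)[of s "{..<N}" z] s by (simp add: z_norm)
      then have "(vnorm (ell s) (restr {..<N} z) powr s) powr (1 / s) \<le> ?A powr (1 / s)"
        using s by (intro powr_mono2) auto
      then show ?thesis using s by (simp add: powr_powr)
    qed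
    finally have le: "?A \<le> C * ?A powr (1 / s)" using C(1) by (simp add: mult_left_mono)
    show ?thesis
    proof (cases "?A = 0")
      case False
      then have A: "?A > 0" using A0 by simp
      have "?A powr (1 / s') = ?A powr (1 - 1 / s)"
        using s' by (metis add_diff_cancel_right')
      also have "\<dots> = ?A / ?A powr (1 / s)" using A by (simp add: powr_diff)
      also have "\<dots> \<le> C" using le A by (simp add: divide_le_eq)
      finally have "(?A powr (1 / s')) powr s' \<le> C powr s'" using s' by (intro powr_mono2) auto
      then show ?thesis using s' A0 by (simp add: powr_powr)
    qed simp
  qed
  have "summable (\<lambda>l. norm (b l) powr s')"
    by (rule bounded_imp_summable[of _ "C powr s'"])
       (use b_bound[of "Suc _"] in \<open>auto simp: lessThan_Suc_atMost\<close>)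
  then obtain m where m: "\<And>A. finite A \<Longrightarrow> A \<subseteq> {m..} \<Longrightarrow> (\<Sum>l\<in>A. norm (b l) powr s') \<le> e powr s'"
    using summable_tail_small[of "\<lambda>l. norm (b l) powr s'" "e powr s'"] assms by auto
  show thesis
  proof (rule that[of m])
    fix x :: "nat \<Rightarrow> 'k"
    assume x: "x \<in> points (ell s)" "\<And>i. i < m \<Longrightarrow> x i = 0"
    let ?V = "vnorm (ell s) x"
    have initial: "norm (S (restr {..<N} x) k) \<le> e * ?V" for N
    proof -
      have "norm (S (restr {..<N} x) k) \<le> (\<Sum>l<N. norm (x l * b l))"
        unfolding expand by (rule norm_sum)
      also have "\<dots> = (\<Sum>l\<in>{m..<N}. norm (b l) * norm (x l))"
        using x(2) by (intro sum.mono_neutral_cong_right) (auto simp: norm_mult not_le)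
      also have "\<dots> \<le> (\<Sum>l\<in>{m..<N}. norm (b l) powr s') powr (1 / s') *
          (\<Sum>l\<in>{m..<N}. norm (x l) powr s) powr (1 / s)"
        using s s' by (intro holder_sum) auto
      also have "\<dots> \<le> (e powr s') powr (1 / s') * (?V powr s) powr (1 / s)"
        using s s' x by (intro mult_mono powr_mono2 m ell_sum_le_norm) (auto intro: sum_nonneg)
      also have "\<dots> = e * ?V" using s s' assms by (simp add: powr_powr)
      finally show ?thesis .
    qed
    show "norm (S x k) \<le> e * ?V"
    proof (rule field_le_epsilon)
      fix d :: real assume d: "0 < d"
      obtain N where N: "vnorm (ell s) (restr {N..} x) \<le> d / (C + 1)"
        using ell_tail_small[of s x "d / (C + 1)"] s x d C(1) by auto
      have "x = (\<lambda>i. restr {..<N} x i + restr {N..} x i)"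
        by (auto simp: restr_def)
      then have "S x = S (\<lambda>i. restr {..<N} x i + restr {N..} x i)" by simp
      also have "\<dots> = (\<lambda>j. S (restr {..<N} x) j + S (restr {N..} x) j)"
        using s x by (intro operators_add[OF S] ell_restr) auto
      finally have "norm (S x k) \<le> norm (S (restr {..<N} x) k) + norm (S (restr {N..} x) k)"
        by (simp add: norm_triangle_ineq)
      also have "norm (S (restr {N..} x) k) \<le> C * vnorm (ell s) (restr {N..} x)"
        using s x by (intro bound ell_restr) auto
      also have "\<dots> \<le> C * (d / (C + 1))" using C(1) N by (intro mult_left_mono) auto
      also have "\<dots> \<le> d" using C(1) d by (simp add: field_simps)
      finally show "norm (S x k) \<le> e * ?V + d" using initial[of N] by simp
    qed
  qed
qed

section \<open>Approximation by block tridiagonal operators\<close>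

text \<open>
  A function \<open>\<beta>\<close> assigns to each coordinate the number of its block. The band part of an operator
  keeps those matrix entries whose row and column lie in equal or adjacent blocks.
\<close>

definition near :: "nat \<Rightarrow> nat set" where
  "near n = {m. m \<le> n + 1 \<and> n \<le> m + 1}"

definition band_part ::
  "(nat \<Rightarrow> nat) \<Rightarrow> ((nat \<Rightarrow> 'k::zero) \<Rightarrow> nat \<Rightarrow> 'k) \<Rightarrow> (nat \<Rightarrow> 'k) \<Rightarrow> nat \<Rightarrow> 'k" where
  "band_part \<beta> S x k = S (restr {l. \<beta> l \<in> near (\<beta> k)} x) k"

lemma finite_near [simp]: "finite (near n)"
  by (rule finite_subset[of _ "{..n + 1}"]) (auto simp: near_def)

lemma card_near_le: "card (near n) \<le> 3"
proof -
  have "card (near n) \<le> card {n - 1..n + 1}"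
    by (rule card_mono) (auto simp: near_def)
  also have "\<dots> \<le> 3" by simp
  finally show ?thesis .
qed

lemma near_sym: "m \<in> near n \<longleftrightarrow> n \<in> near m"
  by (auto simp: near_def)

lemma sum_near_le:
  fixes g :: "nat \<Rightarrow> real"
  assumes "\<And>m. g m \<ge> 0"
  shows "(\<Sum>n<M. \<Sum>m\<in>near n. g m) \<le> 3 * (\<Sum>m<Suc M. g m)"
proof -
  have "(\<Sum>n<M. \<Sum>m\<in>near n. g m) = (\<Sum>n<M. \<Sum>m | m \<in> {..<Suc M} \<and> m \<in> near n. g m)"
    by (intro sum.cong) (auto simp: near_def)
  also have "\<dots> = (\<Sum>m<Suc M. \<Sum>n | n \<in> {..<M} \<and> m \<in> near n. g m)"
    by (rule sum.swap_restrict) auto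
  also have "\<dots> \<le> (\<Sum>m<Suc M. 3 * g m)"
  proof (rule sum_mono)
    fix m
    have "card {n \<in> {..<M}. m \<in> near n} \<le> card (near m)"
      by (rule card_mono) (auto simp: near_sym)
    also note card_near_le
    finally show "(\<Sum>n | n \<in> {..<M} \<and> m \<in> near n. g m) \<le> 3 * g m"
      using assms[of m] by (simp add: mult_right_mono)
  qed
  finally show ?thesis by (simp only: sum_distrib_left)
qed

lemma sum_dyadic_powr_le:
  fixes c t :: real
  assumes "0 \<le> c" "1 \<le> t" "finite A"
  shows "(\<Sum>n\<in>A. (c * (1/2) ^ Suc n) powr t) \<le> c powr t"
proof -
  have "(\<Sum>n\<in>A. (c * (1/2) ^ Suc n) powr t) \<le> (\<Sum>n\<in>A. c powr t * (1/2) ^ Suc n)"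
  proof (rule sum_mono)
    fix n
    have "((1/2::real) ^ Suc n) powr t \<le> ((1/2) ^ Suc n) powr 1"
      using assms by (intro powr_mono') (auto simp: power_le_one mult_le_one simp del: power_Suc)
    then show "(c * (1/2) ^ Suc n) powr t \<le> c powr t * (1/2) ^ Suc n"
      by (simp add: powr_mult mult_left_mono del: power_Suc)
  qed
  also have "\<dots> = c powr t * (\<Sum>n\<in>A. (1/2) ^ Suc n)" by (simp add: sum_distrib_left)
  also have "(\<Sum>n\<in>A. (1/2::real) ^ Suc n) \<le> 1"
    using sum_le_suminf[of "\<lambda>n. (1/2::real) ^ Suc n" A] power_half_series assms
    by (simp add: sums_iff)
  finally show ?thesis by (simp add: mult_left_mono)
qed

text \<open>
  Besides making the blocks finite, the bound \<open>kk\<close> lets the coordinates of \<open>\<nat>\<close> themselves label the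
  entries of a block: the \<open>n\<close>-th block embeds into \<open>{..<kk n}\<close> without renumbering.
\<close>

definition block_index :: "(nat \<Rightarrow> nat) \<Rightarrow> (nat \<Rightarrow> nat) \<Rightarrow> bool" where
  "block_index \<beta> kk \<longleftrightarrow> (\<forall>i. i < kk (\<beta> i))"

lemma block_indexD: "block_index \<beta> kk \<Longrightarrow> i < kk (\<beta> i)"
  by (simp add: block_index_def)

lemma finite_block: "block_index \<beta> kk \<Longrightarrow> finite {i. \<beta> i = n}"
  by (rule finite_subset[of _ "{..<kk n}"]) (auto simp: block_index_def)

lemma sum_by_blocks:
  fixes g :: "nat \<Rightarrow> real"
  assumes fin: "block_index \<beta> kk" and "\<And>i. g i \<ge> 0"
  obtains M where "(\<Sum>i<N. g i) \<le> (\<Sum>n<M. \<Sum>i | \<beta> i = n. g i)"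
proof -
  let ?M = "Suc (Max (\<beta> ` {..<N}))"
  have "(\<Sum>i<N. g i) = (\<Sum>n<?M. \<Sum>i | i \<in> {..<N} \<and> \<beta> i = n. g i)"
    by (rule sum.group[symmetric]) (auto simp: less_Suc_eq_le intro: Max_ge)
  also have "\<dots> \<le> (\<Sum>n<?M. \<Sum>i | \<beta> i = n. g i)"
    using assms by (intro sum_mono sum_mono2 finite_block[OF fin]) auto
  finally show thesis by (rule that)
qed

lemma sum_blocks_eq:
  fixes g :: "nat \<Rightarrow> real"
  assumes fin: "block_index \<beta> kk" and "finite B"
  shows "(\<Sum>n\<in>B. \<Sum>i | \<beta> i = n. g i) = (\<Sum>i | \<beta> i \<in> B. g i)"
    and "finite {i. \<beta> i \<in> B}"
proof -
  have eq: "{i. \<beta> i \<in> B} = (\<Union>n\<in>B. {i. \<beta> i = n})" by auto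
  show "(\<Sum>n\<in>B. \<Sum>i | \<beta> i = n. g i) = (\<Sum>i | \<beta> i \<in> B. g i)"
    unfolding eq using assms(2) by (subst sum.UNION_disjoint) (auto simp: finite_block[OF fin])
  show "finite {i. \<beta> i \<in> B}"
    unfolding eq using assms(2) by (auto simp: finite_block[OF fin])
qed

text \<open>
  The cut points are chosen inductively: given \<open>c n\<close>, any sufficiently large \<open>c (n + 1)\<close> will do,
  because only finitely many rows and columns lie before \<open>c n\<close> and their tails are small.
\<close>

lemma operator_cuts:
  fixes S :: "(nat \<Rightarrow> 'k::scalar_field) \<Rightarrow> nat \<Rightarrow> 'k"
  assumes S: "S \<in> operators (ell s) (ell t)" and s: "1 < s" and t: "0 < t" and e: "0 < e"
  obtains c :: "nat \<Rightarrow> nat" where "strict_mono c" "c 0 = 0"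
    "\<And>n k x. k < c n \<Longrightarrow> x \<in> points (ell s) \<Longrightarrow> (\<And>i. i < c (Suc n) \<Longrightarrow> x i = 0) \<Longrightarrow>
        norm (S x k) \<le> e * (1/2) ^ Suc k * vnorm (ell s) x"
    "\<And>n x A. x \<in> points (ell s) \<Longrightarrow> (\<And>i. c n \<le> i \<Longrightarrow> x i = 0) \<Longrightarrow> finite A \<Longrightarrow> A \<subseteq> {c (Suc n)..} \<Longrightarrow>
        (\<Sum>k\<in>A. norm (S x k) powr t) \<le> (e * (1/2) ^ Suc (Suc n) * vnorm (ell s) x) powr t"
proof -
  define Q where "Q n a b \<longleftrightarrow> a < b \<and>
      (\<forall>k<a. \<forall>x\<in>points (ell s). (\<forall>i<b. x i = 0) \<longrightarrow> norm (S x k) \<le> e * (1/2) ^ Suc k * vnorm (ell s) x) \<and>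
      (\<forall>x\<in>points (ell s). \<forall>A. (\<forall>i\<ge>a. x i = 0) \<longrightarrow> finite A \<longrightarrow> A \<subseteq> {b..} \<longrightarrow>
        (\<Sum>k\<in>A. norm (S x k) powr t) \<le> (e * (1/2) ^ Suc (Suc n) * vnorm (ell s) x) powr t)"
    for n a b :: nat
  have step: "\<exists>b. Q n a b" for n a
  proof -
    have "\<exists>m. \<forall>x\<in>points (ell s). (\<forall>i<m. x i = 0) \<longrightarrow> norm (S x k) \<le> e * (1/2) ^ Suc k * vnorm (ell s) x" for k
      using row_tail[OF S s t, of "e * (1/2) ^ Suc k" k] e by (metis mult_pos_pos zero_less_power half_gt_zero_iff zero_less_one)
    then obtain m where m: "\<And>k x. x \<in> points (ell s) \<Longrightarrow> \<forall>i<m k. x i = 0 \<Longrightarrow>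
        norm (S x k) \<le> e * (1/2) ^ Suc k * vnorm (ell s) x"
      by metis
    have "0 < e * (1/2) ^ Suc (Suc n)" using e by simp
    from columns_tail[OF S less_trans[OF zero_less_one s] t this, of a]
    obtain b where b: "\<And>x A. x \<in> points (ell s) \<Longrightarrow> (\<And>i. a \<le> i \<Longrightarrow> x i = 0) \<Longrightarrow> finite A \<Longrightarrow> A \<subseteq> {b..} \<Longrightarrow>
       (\<Sum>k\<in>A. norm (S x k) powr t) \<le> (e * (1/2) ^ Suc (Suc n) * vnorm (ell s) x) powr t"
      by blast
    define d where "d = Suc (a + b + (\<Sum>k<a. m k))"
    have d: "a < d" "b \<le> d" by (auto simp: d_def)
    have md: "m k \<le> d" if "k < a" for k
      using member_le_sum[of k "{..<a}" m] that by (simp add: d_def)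
    have "Q n a d"
      unfolding Q_def
    proof (intro conjI allI ballI impI)
      fix k and x :: "nat \<Rightarrow> 'k" assume "k < a" "x \<in> points (ell s)" "\<forall>i<d. x i = 0"
      then show "norm (S x k) \<le> e * (1/2) ^ Suc k * vnorm (ell s) x"
        using md[of k] by (intro m) auto
    next
      fix x :: "nat \<Rightarrow> 'k" and A assume "x \<in> points (ell s)" "\<forall>i\<ge>a. x i = 0" "finite A" "A \<subseteq> {d..}"
      then show "(\<Sum>k\<in>A. norm (S x k) powr t) \<le> (e * (1/2) ^ Suc (Suc n) * vnorm (ell s) x) powr t"
        using d by (intro b) auto
    qed (rule d)
    then show ?thesis ..
  qed
  have "\<exists>c. \<forall>n. (n = 0 \<longrightarrow> c n = 0) \<and> Q n (c n) (c (Suc n))"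
    using step by (intro dependent_nat_choice[of "\<lambda>n a. n = 0 \<longrightarrow> a = 0" Q]) auto
  then obtain c where c: "c 0 = 0" "\<And>n. Q n (c n) (c (Suc n))" by blast
  show thesis
  proof (rule that[of c])
    show "strict_mono c" using c(2) by (auto simp: strict_mono_Suc_iff Q_def)
  qed (use c in \<open>auto simp: Q_def simp del: power_Suc\<close>)
qed

text \<open>
  Take as blocks the intervals between consecutive cut points. An entry outside of the band is
  separated from the diagonal by a full block, so it belongs to a tail of an earlier row (above the
  band, \<open>U\<close>) or of an earlier group of columns (below the band, \<open>L\<close>). The tails are chosen
  small along a geometric progression, one for each row in the first case and one for each block
  of rows in the second.
\<close>

lemma band_approximation:
  fixes S :: "(nat \<Rightarrow> 'k::scalar_field) \<Rightarrow> nat \<Rightarrow> 'k"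
  assumes S: "S \<in> operators (ell s) (ell t)" and s: "1 < s" and t: "1 \<le> t" and e: "0 < e"
  obtains \<beta> kk :: "nat \<Rightarrow> nat" where "block_index \<beta> kk"
    "\<forall>x\<in>points (ell s). vnorm (ell t) (\<lambda>k. S x k - band_part \<beta> S x k) \<le> e * vnorm (ell s) x"
proof -
  have e4: "0 < e / 4" using e by simp
  have t0: "0 < t" using t by simp
  obtain c :: "nat \<Rightarrow> nat" where c: "strict_mono c" "c 0 = 0"
    and upper: "\<And>n k x. k < c n \<Longrightarrow> x \<in> points (ell s) \<Longrightarrow> (\<And>i. i < c (Suc n) \<Longrightarrow> x i = 0) \<Longrightarrow>
        norm (S x k) \<le> e / 4 * (1/2) ^ Suc k * vnorm (ell s) x"
    and lower: "\<And>n x A. x \<in> points (ell s) \<Longrightarrow> (\<And>i. c n \<le> i \<Longrightarrow> x i = 0) \<Longrightarrow> finite A \<Longrightarrow> A \<subseteq> {c (Suc n)..} \<Longrightarrow>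
        (\<Sum>k\<in>A. norm (S x k) powr t) \<le> (e / 4 * (1/2) ^ Suc (Suc n) * vnorm (ell s) x) powr t"
    using operator_cuts[OF S s t0 e4] by blast
  define \<beta> where "\<beta> i = (LEAST n. i < c (Suc n))" for i
  have c_ge: "i \<le> c i" for i using c(1) by (rule strict_mono_imp_increasing)
  have \<beta>_less: "i < c (Suc (\<beta> i))" for i
    unfolding \<beta>_def using c_ge[of "Suc i"] by (intro LeastI[of "\<lambda>n. i < c (Suc n)" i]) simp
  have mono: "c m \<le> c n" if "m \<le> n" for m n
    using c(1) that by (simp add: strict_mono_less_eq)
  have \<beta>_le: "\<beta> i \<le> n \<longleftrightarrow> i < c (Suc n)" for i n
  proof
    assume "\<beta> i \<le> n"
    then show "i < c (Suc n)" using \<beta>_less[of i] mono[of "Suc (\<beta> i)" "Suc n"] by simp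
  qed (simp add: \<beta>_def Least_le)
  have remainder: "vnorm (ell t) (\<lambda>k. S x k - band_part \<beta> S x k) \<le> e * vnorm (ell s) x"
    if x: "x \<in> points (ell s)" for x :: "nat \<Rightarrow> 'k"
  proof -
    define U where "U k = S (restr {l. \<beta> k + 2 \<le> \<beta> l} x) k" for k
    define L where "L k = S (restr {l. \<beta> l + 2 \<le> \<beta> k} x) k" for k
    let ?V = "vnorm (ell s) x"
    have s0: "0 < s" using s by simp
    have split: "(\<lambda>k. S x k - band_part \<beta> S x k) = (\<lambda>k. U k + L k)"
    proof
      fix k
      let ?N = "{l. \<beta> l \<in> near (\<beta> k)}" and ?U = "{l. \<beta> k + 2 \<le> \<beta> l}" and ?L = "{l. \<beta> l + 2 \<le> \<beta> k}"
      have "x = (\<lambda>i. restr ?N x i + (restr ?U x i + restr ?L x i))"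
        by (auto simp: restr_def near_def fun_eq_iff)
      then have "S x = S (\<lambda>i. restr ?N x i + (restr ?U x i + restr ?L x i))" by simp
      also have "\<dots> = (\<lambda>j. S (restr ?N x) j + S (\<lambda>i. restr ?U x i + restr ?L x i) j)"
        using x s by (intro operators_add[OF S] ell_restr ell_add(1)) auto
      also have "S (\<lambda>i. restr ?U x i + restr ?L x i) = (\<lambda>j. S (restr ?U x) j + S (restr ?L x) j)"
        using x s by (intro operators_add[OF S] ell_restr) auto
      finally show "S x k - band_part \<beta> S x k = U k + L k"
        by (simp add: band_part_def U_def L_def)
    qed
    have U_sum: "(\<Sum>k<N. norm (U k) powr t) \<le> (e / 4 * ?V) powr t" for N
    proof -
      have "norm (U k) \<le> e / 4 * ?V * (1/2) ^ Suc k" for k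
      proof -
        have "norm (U k) \<le> e / 4 * (1/2) ^ Suc k * vnorm (ell s) (restr {l. \<beta> k + 2 \<le> \<beta> l} x)"
          unfolding U_def
        proof (rule upper)
          show "k < c (Suc (\<beta> k))" by (rule \<beta>_less)
          fix i assume "i < c (Suc (Suc (\<beta> k)))"
          then show "restr {l. \<beta> k + 2 \<le> \<beta> l} x i = 0"
            using \<beta>_le[of i "Suc (\<beta> k)"] by (simp add: restr_def)
        qed (use x s0 in \<open>intro ell_restr\<close>)
        also have "\<dots> \<le> e / 4 * (1/2) ^ Suc k * ?V"
          using e x s0 by (intro mult_left_mono ell_restr) auto
        finally show ?thesis by (simp only: mult_ac)
      qed
      then have "(\<Sum>k<N. norm (U k) powr t) \<le> (\<Sum>k<N. (e / 4 * ?V * (1/2) ^ Suc k) powr t)"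
        using t by (intro sum_mono powr_mono2) auto
      also have "\<dots> \<le> (e / 4 * ?V) powr t"
        using e t by (intro sum_dyadic_powr_le) auto
      finally show ?thesis .
    qed
    have L_sum: "(\<Sum>k<N. norm (L k) powr t) \<le> (e / 4 * ?V) powr t" for N
    proof -
      have block: "(\<Sum>k | k \<in> {..<N} \<and> \<beta> k = n. norm (L k) powr t) \<le> (e / 4 * ?V * (1/2) ^ Suc n) powr t"
        for n
      proof -
        define y where "y = restr {l. \<beta> l + 2 \<le> n} x"
        have Ly: "(\<Sum>k | k \<in> {..<N} \<and> \<beta> k = n. norm (L k) powr t)
            = (\<Sum>k | k \<in> {..<N} \<and> \<beta> k = n. norm (S y k) powr t)"
          by (intro sum.cong) (auto simp: L_def y_def)
        have y: "y \<in> points (ell s)" "vnorm (ell s) y \<le> ?V"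
          unfolding y_def by (intro ell_restr x s0)+
        show ?thesis
        \<comment> \<open>In the first block of rows nothing lies below the band.\<close>
        proof (cases n)
          case 0
          have "S (restr {..<0} y) = (\<lambda>_. 0)"
            using operator_on_initial_segment[OF S s0, of 0 y] by simp
          moreover have "restr {..<0} y = y" by (auto simp: y_def 0 restr_def)
          ultimately have "S y = (\<lambda>_. 0)" by simp
          then show ?thesis unfolding Ly by simp
        next
          case (Suc m)
          have "(\<Sum>k | k \<in> {..<N} \<and> \<beta> k = n. norm (S y k) powr t)
              \<le> (e / 4 * (1/2) ^ Suc (Suc m) * vnorm (ell s) y) powr t"
          proof (rule lower[OF y(1)])
            fix i assume "c m \<le> i"
            then show "y i = 0"
            proof (cases m)
              case 0
              then show ?thesis by (simp add: y_def restr_def Suc)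
            next
              case (Suc m')
              then show ?thesis using \<beta>_le[of i m'] \<open>c m \<le> i\<close> \<open>n = Suc m\<close>
                by (auto simp: y_def restr_def)
            qed
          next
            have "c (Suc m) \<le> k" if "\<beta> k = Suc m" for k
              using \<beta>_le[of k m] that by simp
            then show "{k. k \<in> {..<N} \<and> \<beta> k = n} \<subseteq> {c (Suc m)..}" using Suc by auto
          qed simp
          also have "\<dots> \<le> (e / 4 * (1/2) ^ Suc (Suc m) * ?V) powr t"
            using e t y by (intro powr_mono2 mult_left_mono) auto
          also have "\<dots> = (e / 4 * ?V * (1/2) ^ Suc n) powr t"
            by (simp only: Suc mult_ac)
          finally show ?thesis unfolding Ly .
        qed
      qed
      have "(\<Sum>k<N. norm (L k) powr t) = (\<Sum>n\<in>\<beta> ` {..<N}. \<Sum>k | k \<in> {..<N} \<and> \<beta> k = n. norm (L k) powr t)"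
        by (rule sum.group[symmetric]) auto
      also have "\<dots> \<le> (\<Sum>n\<in>\<beta> ` {..<N}. (e / 4 * ?V * (1/2) ^ Suc n) powr t)"
        by (intro sum_mono block)
      also have "\<dots> \<le> (e / 4 * ?V) powr t"
        using e t by (intro sum_dyadic_powr_le) auto
      finally show ?thesis .
    qed
    have V: "0 \<le> e / 4 * ?V" using e by simp
    note U = ell_norm_leI[OF t0 V U_sum] and L = ell_norm_leI[OF t0 V L_sum]
    show "vnorm (ell t) (\<lambda>k. S x k - band_part \<beta> S x k) \<le> e * ?V"
      unfolding split using ell_add(2)[OF t U(1) L(1)] U(2) L(2) by simp
  qed
  have "block_index \<beta> (\<lambda>n. c (Suc n))" using \<beta>_less by (simp add: block_index_def)
  then show thesis by (rule that) (use remainder in auto)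
qed

lemma band_part_linear:
  fixes S :: "(nat \<Rightarrow> 'k::scalar_field) \<Rightarrow> nat \<Rightarrow> 'k"
  assumes S: "S \<in> operators (ell s) (ell t)" and s: "0 < s" and fin: "block_index \<beta> kk"
  shows "band_part \<beta> S (\<lambda>i. x i + y i) = (\<lambda>k. band_part \<beta> S x k + band_part \<beta> S y k)"
    and "band_part \<beta> S (\<lambda>i. c * x i) = (\<lambda>k. c * band_part \<beta> S x k)"
proof -
  have *: "restr {l. \<beta> l \<in> near n} x \<in> points (ell s)" for n and x :: "nat \<Rightarrow> 'k"
    by (intro ell_restr_finite(1)[OF s] sum_blocks_eq(2)[OF fin]) simp
  show "band_part \<beta> S (\<lambda>i. x i + y i) = (\<lambda>k. band_part \<beta> S x k + band_part \<beta> S y k)"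
    by (simp add: band_part_def fun_eq_iff restr_add operators_add[OF S * *])
  show "band_part \<beta> S (\<lambda>i. c * x i) = (\<lambda>k. c * band_part \<beta> S x k)"
    by (simp add: band_part_def fun_eq_iff restr_scale operators_scale[OF S *])
qed

section \<open>Band operators into or out of Hilbert space\<close>

definition spread :: "(nat \<Rightarrow> nat) \<Rightarrow> (nat \<Rightarrow> 'k::zero) \<Rightarrow> nat \<times> nat \<Rightarrow> 'k" where
  "spread \<beta> x = (\<lambda>(n, i). if \<beta> i = n then x i else 0)"

definition collect :: "(nat \<Rightarrow> nat) \<Rightarrow> (nat \<times> nat \<Rightarrow> 'k) \<Rightarrow> nat \<Rightarrow> 'k" where
  "collect \<beta> y i = y (\<beta> i, i)"

lemma collect_spread [simp]: "collect \<beta> (spread \<beta> x) = x"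
  by (simp add: collect_def spread_def fun_eq_iff)

lemma block_norm_spread_square:
  fixes x :: "nat \<Rightarrow> 'k::scalar_field"
  assumes fin: "block_index \<beta> kk"
  shows "block_norm kk (spread \<beta> x) n powr 2 = (\<Sum>i | \<beta> i = n. norm (x i) powr 2)"
proof -
  have "block_norm kk (spread \<beta> x) n powr 2 = (\<Sum>i<kk n. norm (spread \<beta> x (n, i)) powr 2)"
    by (simp add: block_norm_def L2_set_def sum_nonneg)
  also have "\<dots> = (\<Sum>i | \<beta> i = n. norm (x i) powr 2)"
    using block_indexD[OF fin] by (intro sum.mono_neutral_cong_right) (auto simp: spread_def)
  finally show ?thesis .
qed

lemma sum_collect_le_block_norm:
  fixes y :: "nat \<times> nat \<Rightarrow> 'k::scalar_field"
  assumes fin: "block_index \<beta> kk"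
  shows "(\<Sum>i | \<beta> i = n. norm (collect \<beta> y i) powr 2) \<le> block_norm kk y n powr 2"
proof -
  have "(\<Sum>i | \<beta> i = n. norm (collect \<beta> y i) powr 2)
      = (\<Sum>i | \<beta> i = n. norm (y (n, i)) powr 2)"
    by (rule sum.cong) (auto simp: collect_def)
  also have "\<dots> \<le> (\<Sum>i<kk n. norm (y (n, i)) powr 2)" 
    using block_indexD[OF fin] by (intro sum_mono2) auto
  also have "\<dots> = block_norm kk y n powr 2" by (simp add: block_norm_def L2_set_def sum_nonneg)
  finally show ?thesis .
qed

lemma spread_operator:
  assumes fin: "block_index \<beta> kk"
  shows "spread \<beta> \<in> operators (ell 2) (block_sum kk 2 :: (_, 'k::scalar_field) fspace)"
proof (rule operatorsI[of _ _ _ 1])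
  fix x :: "nat \<Rightarrow> 'k" assume x: "x \<in> points (ell 2)"
  have *: "(\<Sum>n<M. block_norm kk (spread \<beta> x) n powr 2) \<le> vnorm (ell 2) x powr 2" for M
  proof -
    have "(\<Sum>n<M. block_norm kk (spread \<beta> x) n powr 2) = (\<Sum>i | \<beta> i \<in> {..<M}. norm (x i) powr 2)"
      unfolding block_norm_spread_square[OF fin] by (rule sum_blocks_eq[OF fin]) simp
    also have "\<dots> \<le> vnorm (ell 2) x powr 2"
      by (intro ell_sum_le_norm x sum_blocks_eq(2)[OF fin]) auto
    finally show ?thesis .
  qed
  have zero: "spread \<beta> x (n, i) = 0" if "kk n \<le> i" for n i
    using block_indexD[OF fin, of i] that by (auto simp: spread_def)
  show "spread \<beta> x \<in> points (block_sum kk 2)" "vnorm (block_sum kk 2) (spread \<beta> x) \<le> 1 * vnorm (ell 2) x"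
    using block_sum_norm_leI[OF _ ell_norm_nonneg zero *] by auto
qed (simp_all add: spread_def fun_eq_iff)

lemma collect_operator:
  assumes fin: "block_index \<beta> kk"
  shows "collect \<beta> \<in> operators (block_sum kk 2) (ell 2 :: (_, 'k::scalar_field) fspace)"
proof (rule operatorsI[of _ _ _ 1])
  fix y :: "nat \<times> nat \<Rightarrow> 'k" assume y: "y \<in> points (block_sum kk 2)"
  have *: "(\<Sum>i<N. norm (collect \<beta> y i) powr 2) \<le> vnorm (block_sum kk 2) y powr 2" for N
  proof -
    obtain M where "(\<Sum>i<N. norm (collect \<beta> y i) powr 2) \<le>
        (\<Sum>n<M. \<Sum>i | \<beta> i = n. norm (collect \<beta> y i) powr 2)"
      using sum_by_blocks[OF fin, of "\<lambda>i. norm (collect \<beta> y i) powr 2"] by auto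
    also have "\<dots> \<le> (\<Sum>n<M. block_norm kk y n powr 2)"
      by (intro sum_mono sum_collect_le_block_norm[OF fin])
    also have "\<dots> \<le> vnorm (block_sum kk 2) y powr 2"
      using y by (intro block_sum_le_norm) auto
    finally show ?thesis .
  qed
  show "collect \<beta> y \<in> points (ell 2)" "vnorm (ell 2) (collect \<beta> y) \<le> 1 * vnorm (block_sum kk 2) y"
    using ell_norm_leI[OF _ block_sum_norm_nonneg *] by auto
qed (auto simp: collect_def)

text \<open>
  Block \<open>n\<close> of the result depends only on the blocks of \<open>x\<close> adjacent to \<open>n\<close>. So the Hilbert
  norms of the blocks of the result are controlled, block by block, by the \<open>\<ell>\<^sub>s\<close> norms of
  these pieces of \<open>x\<close>, and each piece occurs at most three times: the sequence of block norms lies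
  in \<open>\<ell>\<^sub>s\<close>.
\<close>

lemma band_part_into_ell2:
  fixes S :: "(nat \<Rightarrow> 'k::scalar_field) \<Rightarrow> nat \<Rightarrow> 'k"
  assumes S: "S \<in> operators (ell s) (ell 2)" and s: "0 < s" and fin: "block_index \<beta> kk"
  shows "(\<lambda>x. spread \<beta> (band_part \<beta> S x)) \<in> operators (ell s) (block_sum kk s)"
proof -
  obtain C where C: "C \<ge> 0" "\<And>x. x \<in> points (ell s) \<Longrightarrow> vnorm (ell 2) (S x) \<le> C * vnorm (ell s) x"
    using operators_bound[OF S] by auto
  show ?thesis
  proof (rule operatorsI[of _ _ _ "3 powr (1 / s) * C"])
    fix x :: "nat \<Rightarrow> 'k" assume x: "x \<in> points (ell s)"
    let ?y = "spread \<beta> (band_part \<beta> S x)"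
    define G where "G m = (\<Sum>i | \<beta> i = m. norm (x i) powr s)" for m
    have block: "block_norm kk ?y n powr s \<le> C powr s * (\<Sum>m\<in>near n. G m)" for n
    proof -
      define z where "z = restr {l. \<beta> l \<in> near n} x"
      have z: "z \<in> points (ell s)" unfolding z_def by (intro ell_restr s x)
      have "block_norm kk ?y n powr 2 = (\<Sum>i | \<beta> i = n. norm (S z i) powr 2)"
        unfolding block_norm_spread_square[OF fin] by (intro sum.cong) (auto simp: band_part_def z_def)
      also have "\<dots> \<le> vnorm (ell 2) (S z) powr 2"
        by (intro ell_sum_le_norm operators_closed[OF S z] finite_block[OF fin]) auto
      finally have "block_norm kk ?y n \<le> vnorm (ell 2) (S z)"
        by simp
      also have "\<dots> \<le> C * vnorm (ell s) z" by (rule C(2)[OF z])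
      finally have "block_norm kk ?y n powr s \<le> (C * vnorm (ell s) z) powr s"
        using s by (intro powr_mono2) auto
      also have "\<dots> = C powr s * vnorm (ell s) z powr s" by (rule powr_mult)
      also have "vnorm (ell s) z powr s \<le> (\<Sum>m\<in>near n. G m)"
        unfolding z_def G_def sum_blocks_eq(1)[OF fin finite_near]
        by (intro ell_restr_finite(2)[OF s] sum_blocks_eq(2)[OF fin] finite_near)
      finally show ?thesis by (simp add: mult_left_mono)
    qed
    have *: "(\<Sum>n<M. block_norm kk ?y n powr s) \<le> (3 powr (1 / s) * C * vnorm (ell s) x) powr s" for M
    proof -
      have "(\<Sum>n<M. block_norm kk ?y n powr s) \<le> C powr s * (\<Sum>n<M. \<Sum>m\<in>near n. G m)"
        unfolding sum_distrib_left[of "C powr s" _ "{..<M}"] by (intro sum_mono block)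
      also have "\<dots> \<le> C powr s * (3 * (\<Sum>m<Suc M. G m))"
        by (intro mult_left_mono sum_near_le) (auto simp: G_def sum_nonneg)
      also have "\<dots> \<le> C powr s * (3 * vnorm (ell s) x powr s)"
      proof -
        have "(\<Sum>m<Suc M. G m) = (\<Sum>i | \<beta> i \<in> {..<Suc M}. norm (x i) powr s)"
          unfolding G_def by (rule sum_blocks_eq[OF fin]) simp
        also have "\<dots> \<le> vnorm (ell s) x powr s"
          by (intro ell_sum_le_norm[OF s x] sum_blocks_eq(2)[OF fin]) simp
        finally show ?thesis by (intro mult_left_mono) auto
      qed
      finally show ?thesis using s by (simp add: powr_mult powr_powr mult_ac)
    qed
    have zero: "?y (n, i) = 0" if "kk n \<le> i" for n i
      using block_indexD[OF fin, of i] that by (auto simp: spread_def)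
    show "?y \<in> points (block_sum kk s)"
      "vnorm (block_sum kk s) ?y \<le> 3 powr (1 / s) * C * vnorm (ell s) x"
      using block_sum_norm_leI[OF s _ zero *] C(1) by auto
  next
    fix x y :: "nat \<Rightarrow> 'k"
    show "spread \<beta> (band_part \<beta> S (\<lambda>i. x i + y i))
       = (\<lambda>j. spread \<beta> (band_part \<beta> S x) j + spread \<beta> (band_part \<beta> S y) j)"
      unfolding band_part_linear[OF S s fin] by (auto simp: spread_def)
  next
    fix c and x :: "nat \<Rightarrow> 'k"
    show "spread \<beta> (band_part \<beta> S (\<lambda>i. c * x i)) = (\<lambda>j. c * spread \<beta> (band_part \<beta> S x) j)"
      unfolding band_part_linear[OF S s fin] by (auto simp: spread_def)
  qed
qed

text \<open>
  This is the dual situation: each block of the result needs only the Hilbert norms of three blocks of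
  the argument, so \<open>\<ell>\<^sub>t\<close>-summability of the block norms already suffices to define it.
\<close>

lemma band_part_from_ell2:
  fixes S :: "(nat \<Rightarrow> 'k::scalar_field) \<Rightarrow> nat \<Rightarrow> 'k"
  assumes S: "S \<in> operators (ell 2) (ell t)" and t: "0 < t" and fin: "block_index \<beta> kk"
  shows "(\<lambda>y. band_part \<beta> S (collect \<beta> y)) \<in> operators (block_sum kk t) (ell t)"
proof -
  obtain C where C: "C \<ge> 0" "\<And>x. x \<in> points (ell 2) \<Longrightarrow> vnorm (ell t) (S x) \<le> C * vnorm (ell 2) x"
    using operators_bound[OF S] by auto
  show ?thesis
  proof (rule operatorsI[of _ _ _ "(3 powr t * 3) powr (1 / t) * C"])
    fix y :: "nat \<times> nat \<Rightarrow> 'k" assume y: "y \<in> points (block_sum kk t)"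
    let ?x = "collect \<beta> y"
    let ?A = "\<lambda>k. norm (band_part \<beta> S ?x k) powr t"
    define b where "b = block_norm kk y"
    have b0: "b m \<ge> 0" for m by (simp add: b_def)
    have block: "(\<Sum>k | \<beta> k = n. ?A k) \<le> C powr t * (3 powr t * (\<Sum>m\<in>near n. b m powr t))" for n
    proof -
      define z where "z = restr {l. \<beta> l \<in> near n} ?x"
      have z: "z \<in> points (ell 2)"
        unfolding z_def by (intro ell_restr_finite(1) sum_blocks_eq(2)[OF fin] finite_near) simp
      have "vnorm (ell 2) z powr 2 \<le> (\<Sum>l | \<beta> l \<in> near n. norm (?x l) powr 2)"
        unfolding z_def by (intro ell_restr_finite(2) sum_blocks_eq(2)[OF fin] finite_near) simp
      also have "\<dots> \<le> (\<Sum>m\<in>near n. b m powr 2)"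
        unfolding sum_blocks_eq(1)[OF fin finite_near, symmetric] b_def
        by (intro sum_mono sum_collect_le_block_norm[OF fin])
      also have "\<dots> \<le> (\<Sum>m\<in>near n. b m)\<^sup>2"
      proof -
        have "(\<Sum>m\<in>near n. b m powr 2) = (\<Sum>m\<in>near n. b m * b m)"
          using b0 by (simp add: power2_eq_square)
        also have "\<dots> \<le> (\<Sum>m\<in>near n. b m * (\<Sum>m\<in>near n. b m))"
          using b0 by (intro sum_mono mult_left_mono member_le_sum) auto
        finally show ?thesis by (simp add: sum_distrib_right power2_eq_square)
      qed
      finally have "(vnorm (ell 2) z)\<^sup>2 \<le> (\<Sum>m\<in>near n. b m)\<^sup>2" by simp
      then have z_le: "vnorm (ell 2) z \<le> (\<Sum>m\<in>near n. b m)"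
        by (rule power2_le_imp_le) (intro sum_nonneg b0)
      have "(\<Sum>k | \<beta> k = n. ?A k) = (\<Sum>k | \<beta> k = n. norm (S z k) powr t)"
        by (intro sum.cong) (auto simp: band_part_def z_def)
      also have "\<dots> \<le> vnorm (ell t) (S z) powr t"
        using t by (intro ell_sum_le_norm operators_closed[OF S z] finite_block[OF fin])
      also have "\<dots> \<le> (C * (\<Sum>m\<in>near n. b m)) powr t"
      proof -
        have "vnorm (ell t) (S z) \<le> C * vnorm (ell 2) z" by (rule C(2)[OF z])
        also have "\<dots> \<le> C * (\<Sum>m\<in>near n. b m)" using C(1) z_le by (rule mult_left_mono[rotated])
        finally show ?thesis using t by (intro powr_mono2) auto
      qed
      also have "\<dots> = C powr t * (\<Sum>m\<in>near n. b m) powr t" by (rule powr_mult)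
      also have "(\<Sum>m\<in>near n. b m) powr t \<le> real (card (near n)) powr t * (\<Sum>m\<in>near n. b m powr t)"
        using t b0 by (intro powr_sum_le) auto
      also have "\<dots> \<le> 3 powr t * (\<Sum>m\<in>near n. b m powr t)"
        using t card_near_le[of n] by (intro mult_right_mono powr_mono2) (auto intro: sum_nonneg)
      finally show ?thesis by (simp add: mult_left_mono)
    qed
    have *: "(\<Sum>k<N. ?A k) \<le> ((3 powr t * 3) powr (1 / t) * C * vnorm (block_sum kk t) y) powr t" for N
    proof -
      obtain M where "(\<Sum>k<N. ?A k) \<le> (\<Sum>n<M. \<Sum>k | \<beta> k = n. ?A k)"
        using sum_by_blocks[OF fin, of ?A] by auto
      also have "\<dots> \<le> (\<Sum>n<M. C powr t * (3 powr t * (\<Sum>m\<in>near n. b m powr t)))"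
        by (intro sum_mono block)
      also have "\<dots> = C powr t * (3 powr t * (\<Sum>n<M. \<Sum>m\<in>near n. b m powr t))"
        by (simp only: sum_distrib_left)
      also have "\<dots> \<le> C powr t * (3 powr t * (3 * (\<Sum>m<Suc M. b m powr t)))"
        by (intro mult_left_mono sum_near_le) auto
      also have "\<dots> \<le> C powr t * (3 powr t * (3 * vnorm (block_sum kk t) y powr t))"
        unfolding b_def using t y by (intro mult_left_mono block_sum_le_norm) auto
      also have "\<dots> = ((3 powr t * 3) powr (1 / t) * C * vnorm (block_sum kk t) y) powr t"
      proof -
        have "((3 powr t * 3) powr (1 / t)) powr t = (3 powr t * 3 :: real)"
          using t by (simp add: powr_powr)
        then show ?thesis by (simp add: powr_mult[of _ _ t] del: powr_powr)
      qed
      finally show ?thesis .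
    qed
    show "band_part \<beta> S ?x \<in> points (ell t)"
      "vnorm (ell t) (band_part \<beta> S ?x) \<le> (3 powr t * 3) powr (1 / t) * C * vnorm (block_sum kk t) y"
      using ell_norm_leI[OF t _ *] C(1) by auto
  next
    fix x y :: "nat \<times> nat \<Rightarrow> 'k"
    have "collect \<beta> (\<lambda>i. x i + y i) = (\<lambda>i. collect \<beta> x i + collect \<beta> y i)"
      by (simp add: collect_def fun_eq_iff)
    then show "band_part \<beta> S (collect \<beta> (\<lambda>i. x i + y i))
       = (\<lambda>j. band_part \<beta> S (collect \<beta> x) j + band_part \<beta> S (collect \<beta> y) j)"
      using band_part_linear(1)[OF S _ fin] by simp
  next
    fix c and x :: "nat \<times> nat \<Rightarrow> 'k"
    have "collect \<beta> (\<lambda>i. c * x i) = (\<lambda>i. c * collect \<beta> x i)"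
      by (simp add: collect_def fun_eq_iff)
    then show "band_part \<beta> S (collect \<beta> (\<lambda>i. c * x i)) = (\<lambda>j. c * band_part \<beta> S (collect \<beta> x) j)"
      using band_part_linear(2)[OF S _ fin] by simp
  qed
qed

section \<open>Approximation by operators that factor through an intermediate space\<close>

lemma factors_through_blocks:
  fixes B :: "(nat \<Rightarrow> 'k::scalar_field) \<Rightarrow> nat \<times> nat \<Rightarrow> 'k" and A :: "(nat \<times> nat \<Rightarrow> 'k) \<Rightarrow> nat \<Rightarrow> 'k"
  assumes "0 < s" "s \<le> r" "1 < r" "r \<le> t"
    and B: "B \<in> operators (ell p) (block_sum k s)" and A: "A \<in> operators (block_sum k t) (ell q)"
  shows "factors_through (ell r) (ell p) (ell q) (\<lambda>x. A (B x))"
    and "(\<lambda>x. A (B x)) \<in> operators (ell p) (ell q)"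
proof -
  obtain J :: "(nat \<times> nat \<Rightarrow> 'k) \<Rightarrow> nat \<Rightarrow> 'k" and Q where
    J: "J \<in> operators (block_sum k s) (ell r)" and Q: "Q \<in> operators (ell r) (block_sum k t)"
    and QJ: "\<And>x. x \<in> points (block_sum k s) \<Longrightarrow> Q (J x) = x"
    using block_sum_identity_factors[OF assms(1-4), of k, where 'k='k] by blast
  show "factors_through (ell r) (ell p) (ell q) (\<lambda>x. A (B x))"
    unfolding factors_through_def
  proof (intro bexI ballI)
    show "(\<lambda>x. J (B x)) \<in> operators (ell p) (ell r)"
      using B J by (rule operators_compose) simp_all
    show "(\<lambda>x. A (Q x)) \<in> operators (ell r) (ell q)"
      using Q A by (rule operators_compose) simp_all
    show "A (B x) = A (Q (J (B x)))" if "x \<in> points (ell p)" for x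
      using QJ[OF operators_closed[OF B that]] by simp
  qed
  have "(\<lambda>x. x) \<in> operators (block_sum k s) (block_sum k t :: (_, 'k) fspace)"
    using assms by (intro block_sum_inclusion) auto
  then have "B \<in> operators (ell p) (block_sum k t)"
    using operators_compose[OF B] by simp
  then show "(\<lambda>x. A (B x)) \<in> operators (ell p) (ell q)"
    using A by (rule operators_compose) simp_all
qed

text \<open>
  The band part factors through the formal identity between the block sums with exponents \<open>s\<close> and
  \<open>t\<close>. At the end where the exponent is \<open>2\<close> the block sum is \<open>\<ell>\<^sub>2\<close> itself, cut into blocks.
\<close>

lemma hilbert_approximation:
  fixes S :: "(nat \<Rightarrow> 'k::scalar_field) \<Rightarrow> nat \<Rightarrow> 'k"
  assumes S: "S \<in> operators (ell s) (ell t)" and "1 < s" "s \<le> r" "r \<le> t" and hilbert: "s = 2 \<or> t = 2" and e: "0 < e"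
  obtains S' where "S' \<in> operators (ell s) (ell t)" "factors_through (ell r) (ell s) (ell t) S'"
    "\<forall>x\<in>points (ell s). vnorm (ell t) (\<lambda>k. S x k - S' x k) \<le> e * vnorm (ell s) x"
proof -
  have t1: "1 \<le> t" and s0: "0 < s" and t0: "0 < t" and r1: "1 < r" using assms by auto
  obtain \<beta> kk :: "nat \<Rightarrow> nat" where fin: "block_index \<beta> kk"
    and approx: "\<forall>x\<in>points (ell s).
      vnorm (ell t) (\<lambda>k. S x k - band_part \<beta> S x k) \<le> e * vnorm (ell s) x"
    by (rule band_approximation[OF S assms(2) t1 e])
  have "factors_through (ell r) (ell s) (ell t) (band_part \<beta> S) \<and> band_part \<beta> S \<in> operators (ell s) (ell t)"
    using hilbert
  proof
    assume t: "t = 2"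
    have B: "(\<lambda>x. spread \<beta> (band_part \<beta> S x)) \<in> operators (ell s) (block_sum kk s)"
      using S s0 fin unfolding t by (rule band_part_into_ell2)
    have A: "collect \<beta> \<in> operators (block_sum kk t) (ell t :: (_, 'k) fspace)"
      unfolding t using fin by (rule collect_operator)
    show ?thesis
      using factors_through_blocks[OF s0 assms(3) r1 assms(4) B A] by simp
  next
    assume s: "s = 2"
    have B: "spread \<beta> \<in> operators (ell s) (block_sum kk s :: (_, 'k) fspace)"
      unfolding s using fin by (rule spread_operator)
    have A: "(\<lambda>y. band_part \<beta> S (collect \<beta> y)) \<in> operators (block_sum kk t) (ell t)"
      using S t0 fin unfolding s by (rule band_part_from_ell2)
    show ?thesis
      using factors_through_blocks[OF s0 assms(3) r1 assms(4) B A] by simp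
  qed
  then show thesis by (intro that[OF _ _ approx]) simp_all
qed

lemma vnorm_le_opnorm:
  fixes T :: "('i \<Rightarrow> 'k::scalar_field) \<Rightarrow> ('j \<Rightarrow> 'k)"
  assumes "\<And>x. x \<in> points X \<Longrightarrow> vnorm Y (T x) \<le> C * vnorm X x"
    and "0 \<le> C" "x \<in> points X" "vnorm X x \<le> 1"
  shows "vnorm Y (T x) \<le> opnorm X Y T"
  unfolding opnorm_def
proof (rule cSUP_upper)
  show "bdd_above ((\<lambda>x. vnorm Y (T x)) ` {x \<in> points X. vnorm X x \<le> 1})"
  proof (rule bdd_aboveI2)
    fix z assume z: "z \<in> {x \<in> points X. vnorm X x \<le> 1}"
    then have "vnorm Y (T z) \<le> C * vnorm X z" using assms(1) by blast
    also have "\<dots> \<le> C * 1" using assms(2) z by (intro mult_left_mono) auto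
    finally show "vnorm Y (T z) \<le> C" by simp
  qed
qed (use assms in auto)

text \<open>
  If \<open>r \<le> 2\<close> then \<open>r\<close> lies between \<open>p\<close> and \<open>2\<close>, and the operator from \<open>\<ell>\<^sub>p\<close> into \<open>\<ell>\<^sub>2\<close> is replaced; otherwise
  \<open>r\<close> lies between \<open>2\<close> and \<open>q\<close>, and the operator from \<open>\<ell>\<^sub>2\<close> to \<open>\<ell>\<^sub>q\<close> is replaced.
\<close>

lemma factoring_approximation:
  fixes S :: "(nat \<Rightarrow> 'k::scalar_field) \<Rightarrow> nat \<Rightarrow> 'k"
  assumes "1 < p" "p \<le> 2" "2 \<le> q" "p \<le> r" "r \<le> q" and e: "0 < e"
    and S: "factors_through (ell 2) (ell p) (ell q) S"
  obtains S' where "S' \<in> operators (ell p) (ell q)" "factors_through (ell r) (ell p) (ell q) S'"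
    "\<forall>x\<in>points (ell p). vnorm (ell q) (\<lambda>j. S x j - S' x j) \<le> e * vnorm (ell p) x"
proof -
  obtain B A where B: "B \<in> operators (ell p) (ell 2 :: (nat, 'k) fspace)"
    and A: "A \<in> operators (ell 2 :: (nat, 'k) fspace) (ell q)"
    and SAB: "\<forall>x\<in>points (ell p). S x = A (B x)"
    using S unfolding factors_through_def by blast
  have q: "1 \<le> q" using assms by simp
  obtain a where a: "a \<ge> 0" "\<And>y. y \<in> points (ell 2) \<Longrightarrow> vnorm (ell q) (A y) \<le> a * vnorm (ell 2) y"
    using operators_bound[OF A ell_norm_nonneg] by blast
  obtain b where b: "b \<ge> 0" "\<And>x. x \<in> points (ell p) \<Longrightarrow> vnorm (ell 2) (B x) \<le> b * vnorm (ell p) x"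
    using operators_bound[OF B ell_norm_nonneg] by blast
  show thesis
  proof (cases "r \<le> 2")
    case True
    have d: "0 < e / (a + 1)" using e a(1) by simp
    obtain B' where B': "B' \<in> operators (ell p) (ell 2)"
      and fac: "factors_through (ell r) (ell p) (ell 2) B'"
      and approx: "\<forall>x\<in>points (ell p). vnorm (ell 2) (\<lambda>k. B x k - B' x k) \<le> e / (a + 1) * vnorm (ell p) x"
      by (rule hilbert_approximation[OF B assms(1,4) True disjI2[OF refl] d])
    obtain C D where C: "C \<in> operators (ell p) (ell r :: (nat, 'k) fspace)"
      and D: "D \<in> operators (ell r :: (nat, 'k) fspace) (ell 2)"
      and CD: "\<forall>x\<in>points (ell p). B' x = D (C x)"
      using fac unfolding factors_through_def by blast
    show thesis
    proof (rule that[of "\<lambda>x. A (B' x)"])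
      show "(\<lambda>x. A (B' x)) \<in> operators (ell p) (ell q)"
        using B' A by (rule operators_compose) simp_all
      show "factors_through (ell r) (ell p) (ell q) (\<lambda>x. A (B' x))"
        unfolding factors_through_def
      proof (intro bexI ballI)
        show "(\<lambda>z. A (D z)) \<in> operators (ell r) (ell q)"
          using D A by (rule operators_compose) simp_all
        show "A (B' x) = A (D (C x))" if "x \<in> points (ell p)" for x
          using CD that by simp
      qed (rule C)
      show "\<forall>x\<in>points (ell p). vnorm (ell q) (\<lambda>j. S x j - A (B' x) j) \<le> e * vnorm (ell p) x"
      proof
        fix x :: "nat \<Rightarrow> 'k" assume x: "x \<in> points (ell p)"
        let ?z = "\<lambda>k. B x k - B' x k"
        have pts: "B x \<in> points (ell 2)" "B' x \<in> points (ell 2)"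
          using operators_closed[OF B x] operators_closed[OF B' x] by auto
        have diff: "(\<lambda>j. S x j - A (B' x) j) = A ?z"
          using operators_diff[OF A _ pts] SAB x by simp
        have "vnorm (ell q) (A ?z) \<le> a * vnorm (ell 2) ?z"
          using pts by (intro a(2) ell_diff) auto
        also have "\<dots> \<le> a * (e / (a + 1) * vnorm (ell p) x)"
          using approx x a(1) by (intro mult_left_mono) auto
        also have "\<dots> = a / (a + 1) * (e * vnorm (ell p) x)" by simp
        also have "\<dots> \<le> 1 * (e * vnorm (ell p) x)"
          using a(1) e by (intro mult_right_mono) auto
        finally show "vnorm (ell q) (\<lambda>j. S x j - A (B' x) j) \<le> e * vnorm (ell p) x"
          unfolding diff by simp
      qed
    qed
  next
    case False
    then have r2: "2 \<le> r" by simp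
    have d: "0 < e / (b + 1)" using e b(1) by simp
    obtain A' where A': "A' \<in> operators (ell 2) (ell q)"
      and fac: "factors_through (ell r) (ell 2) (ell q) A'"
      and approx: "\<forall>y\<in>points (ell 2). vnorm (ell q) (\<lambda>k. A y k - A' y k) \<le> e / (b + 1) * vnorm (ell 2) y"
      by (rule hilbert_approximation[OF A _ r2 assms(5) disjI1[OF refl] d]) simp
    obtain C D where C: "C \<in> operators (ell 2) (ell r :: (nat, 'k) fspace)"
      and D: "D \<in> operators (ell r :: (nat, 'k) fspace) (ell q)"
      and CD: "\<forall>y\<in>points (ell 2). A' y = D (C y)"
      using fac unfolding factors_through_def by blast
    show thesis
    proof (rule that[of "\<lambda>x. A' (B x)"])
      show "(\<lambda>x. A' (B x)) \<in> operators (ell p) (ell q)"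
        using B A' by (rule operators_compose) simp_all
      show "factors_through (ell r) (ell p) (ell q) (\<lambda>x. A' (B x))"
        unfolding factors_through_def
      proof (intro bexI ballI)
        show "(\<lambda>x. C (B x)) \<in> operators (ell p) (ell r)"
          using B C by (rule operators_compose) simp_all
        show "A' (B x) = D (C (B x))" if "x \<in> points (ell p)" for x
          using CD operators_closed[OF B that] by simp
      qed (rule D)
      show "\<forall>x\<in>points (ell p). vnorm (ell q) (\<lambda>j. S x j - A' (B x) j) \<le> e * vnorm (ell p) x"
      proof
        fix x :: "nat \<Rightarrow> 'k" assume x: "x \<in> points (ell p)"
        have "vnorm (ell q) (\<lambda>j. S x j - A' (B x) j) \<le> e / (b + 1) * vnorm (ell 2) (B x)"
          using approx operators_closed[OF B x] SAB x by simp
        also have "\<dots> \<le> e / (b + 1) * (b * vnorm (ell p) x)"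
          using b x e by (intro mult_left_mono) auto
        also have "\<dots> = b / (b + 1) * (e * vnorm (ell p) x)" by simp
        also have "\<dots> \<le> 1 * (e * vnorm (ell p) x)"
          using b(1) e by (intro mult_right_mono) auto
        finally show "vnorm (ell q) (\<lambda>j. S x j - A' (B x) j) \<le> e * vnorm (ell p) x" by simp
      qed
    qed
  qed
qed

lemma closure_factoring_mono:
  fixes p q r :: real
  assumes "1 < p" "p \<le> 2" "2 \<le> q" "p \<le> r" "r \<le> q"
  shows "closure_factoring (ell 2 :: (nat, 'k::scalar_field) fspace) p q
           \<subseteq> closure_factoring (ell r :: (nat, 'k) fspace) p q"
proof
  fix T :: "(nat \<Rightarrow> 'k) \<Rightarrow> nat \<Rightarrow> 'k"
  assume "T \<in> closure_factoring (ell 2 :: (nat, 'k) fspace) p q"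
  then have T: "T \<in> operators (ell p) (ell q)"
    and close: "\<And>e. e > 0 \<Longrightarrow> \<exists>S\<in>operators (ell p) (ell q). factors_through (ell 2 :: (nat, 'k) fspace) (ell p) (ell q) S \<and>
        opnorm (ell p) (ell q) (\<lambda>x j. T x j - S x j) < e"
    unfolding closure_factoring_def by blast+
  have q: "1 \<le> q" using assms by simp
  have "\<exists>S'\<in>operators (ell p) (ell q). factors_through (ell r :: (nat, 'k) fspace) (ell p) (ell q) S' \<and>
        opnorm (ell p) (ell q) (\<lambda>x j. T x j - S' x j) < e" if e: "e > 0" for e
  proof -
    have e8: "e / 8 > 0" using e by simp
    obtain S where S: "S \<in> operators (ell p) (ell q)"
      and fac: "factors_through (ell 2 :: (nat, 'k) fspace) (ell p) (ell q) S"
      and TS: "opnorm (ell p) (ell q) (\<lambda>x j. T x j - S x j) < e / 8"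
      using close[OF e8] by blast
    obtain S' where S': "S' \<in> operators (ell p) (ell q)"
      and fac': "factors_through (ell r :: (nat, 'k) fspace) (ell p) (ell q) S'"
      and SS': "\<forall>x\<in>points (ell p). vnorm (ell q) (\<lambda>j. S x j - S' x j) \<le> e / 8 * vnorm (ell p) x"
      by (rule factoring_approximation[OF assms e8 fac])
    obtain C D where C: "C \<ge> 0" "\<And>x. x \<in> points (ell p) \<Longrightarrow> vnorm (ell q) (T x) \<le> C * vnorm (ell p) x"
      and D: "D \<ge> 0" "\<And>x. x \<in> points (ell p) \<Longrightarrow> vnorm (ell q) (S x) \<le> D * vnorm (ell p) x"
      using operators_bound[OF T ell_norm_nonneg] operators_bound[OF S ell_norm_nonneg] by metis
    have bounded: "vnorm (ell q) (\<lambda>j. T x j - S x j) \<le> 2 * (C + D) * vnorm (ell p) x"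
      if x: "x \<in> points (ell p)" for x
    proof -
      have "vnorm (ell q) (\<lambda>j. T x j - S x j) \<le> 2 * (vnorm (ell q) (T x) + vnorm (ell q) (S x))"
        by (intro ell_diff(2)[OF q] operators_closed[OF T x] operators_closed[OF S x])
      also have "\<dots> \<le> 2 * (C * vnorm (ell p) x + D * vnorm (ell p) x)"
        using C(2)[OF x] D(2)[OF x] by simp
      finally show ?thesis by (simp add: algebra_simps)
    qed
    have "opnorm (ell p) (ell q) (\<lambda>x j. T x j - S' x j) \<le> e / 2"
      unfolding opnorm_def
    proof (rule cSUP_least)
      have "restr {} (\<lambda>_. 0) \<in> points (ell p :: (nat, 'k) fspace)"
        "vnorm (ell p) (restr {} (\<lambda>_. 0 :: 'k)) \<le> 0"
        using ell_norm_leI[of p 0 "restr {} (\<lambda>_. 0 :: 'k)"] assms by (auto simp: restr_def)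
      then show "{x \<in> points (ell p :: (nat, 'k) fspace). vnorm (ell p) x \<le> 1} \<noteq> {}"
        using zero_le_one order_trans by blast
    next
      fix x :: "nat \<Rightarrow> 'k" assume "x \<in> {x \<in> points (ell p). vnorm (ell p) x \<le> 1}"
      then have x: "x \<in> points (ell p)" "vnorm (ell p) x \<le> 1" by auto
      let ?u = "\<lambda>j. T x j - S x j" and ?v = "\<lambda>j. S x j - S' x j"
      have u: "?u \<in> points (ell q)" and v: "?v \<in> points (ell q)"
        by (intro ell_diff(1)[OF q] operators_closed[OF T x(1)] operators_closed[OF S x(1)]
            operators_closed[OF S' x(1)])+
      have "vnorm (ell q) ?u \<le> opnorm (ell p) (ell q) (\<lambda>x j. T x j - S x j)"
        using C(1) D(1) by (intro vnorm_le_opnorm[OF bounded _ x]) auto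
      then have u_le: "vnorm (ell q) ?u \<le> e / 8" using TS by simp
      have "vnorm (ell q) ?v \<le> e / 8 * vnorm (ell p) x" using SS' x by blast
      also have "\<dots> \<le> e / 8 * 1" using e x by (intro mult_left_mono) auto
      finally have v_le: "vnorm (ell q) ?v \<le> e / 8" by simp
      have "(\<lambda>j. T x j - S' x j) = (\<lambda>j. ?u j + ?v j)" by simp
      then show "vnorm (ell q) (\<lambda>j. T x j - S' x j) \<le> e / 2"
        using ell_add(2)[OF q u v] u_le v_le by simp
    qed
    then show ?thesis using S' fac' e by (intro bexI[of _ S']) auto
  qed
  then show "T \<in> closure_factoring (ell r :: (nat, 'k) fspace) p q"
    using T unfolding closure_factoring_def by blast
qed

theorem mainTheorem10:
  fixes p q r :: real
  assumes "1 < p" and "p \<le> 2" and "2 \<le> q" and "p < q"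
    and "p < r" and "r < q"
  shows "(\<forall>T \<in> (pelczynski_operators p q :: ((nat \<Rightarrow> 'k::scalar_field) \<Rightarrow> (nat \<Rightarrow> 'k)) set).
            factors_through (ell r) (ell p) (ell q) T) \<and>
         closure_factoring (ell 2 :: (nat, 'k) fspace) p q
           \<subseteq> closure_factoring (ell r :: (nat, 'k) fspace) p q"
proof
  show "\<forall>T \<in> (pelczynski_operators p q :: ((nat \<Rightarrow> 'k) \<Rightarrow> (nat \<Rightarrow> 'k)) set).
      factors_through (ell r) (ell p) (ell q) T"
    using assms by (intro ballI pelczynski_factors[of p r q]) auto
  show "closure_factoring (ell 2 :: (nat, 'k) fspace) p q \<subseteq> closure_factoring (ell r :: (nat, 'k) fspace) p q"
    using assms by (intro closure_factoring_mono) auto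
qed

end
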